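(* Let $\mathcal{C}$ be a semi-abelian category such that, for every object $B$ of $\mathcal{C}$, the kernel functor $\mathrm{Ker}_B\colon \mathrm{Pt}_B(\mathcal{C})\to\mathcal{C}$ preserves jointly strongly epimorphic pairs. If $H$ and $K$ are characteristic subobjects of an object $G$ of $\mathcal{C}$, then the Higgins commutator $[H,K]$ is a characteristic subobject of $G$.
   Context: For an object $B$ of a pointed category $\mathcal{C}$ with finite limits and finite coproducts, let $\mathrm{Pt}_B(\mathcal{C})$ be the category of points over $B$: objects are split epimorphisms $(A,p,s)$ with $p\colon A\to B$, $s\colon B\to A$, $ps=1_B$; morphisms $(A,p,s)\to(A',p',s')$ are arrows $f\colon A\to A'$ with $p'f=p$, $fs=s'$. The functor $\mathrm{Ker}_B\colon \mathrm{Pt}_B(\mathcal{C})\to\mathcal{C}$, $(A,p,s)\mapsto \mathrm{Ker}(p)$, is right adjoint to $B+(-)$, which sends $X$ to the point $(B+X,[1,0],\iota_B)$. The induced monad on $\mathcal{C}$ is denoted $B\flat(-)$, so that $B\flat X$ is the kernel of $[1,0]\colon B+X\to B$. An (internal) action of $B$ on $X$ is an algebra $\xi\colon B\flat X\to X$ for this monad. A subobject $h\colon H\rightarrowtail G$ is called characteristic in $G$ if for every object $B$ and every action $\xi\colon B\flat G\to G$ there exists a (unique) action $\overline{\xi}\colon B\flat H\to H$ with $h\,\overline{\xi}=\xi\,(1_B\flat h)$. A pair of arrows with common codomain is jointly strongly epimorphic if it does not factor through any proper subobject of the codomain. Given subobjects $h\colon H\rightarrowtail G$ and $k\colon K\rightarrowtail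 G$, let $\Sigma_{H,K}=\langle[1,0],[0,1]\rangle\colon H+K\to H\times K$ be the canonical map and $\sigma_{H,K}\colon H\diamond K\to H+K$ its kernel. The Higgins commutator $[H,K]$ is the regular image of the composite $[h,k]\,\sigma_{H,K}\colon H\diamond K\to G$, regarded as a subobject of $G$. *)

theory Defs
  imports Main
begin

section \<open>Categories\<close>

record ('o, 'm) cat =
  Obj :: "'o set"
  Arr :: "'m set"
  Dom :: "'m \<Rightarrow> 'o"
  Cod :: "'m \<Rightarrow> 'o"
  Ident :: "'o \<Rightarrow> 'm"
  Comp :: "'m \<Rightarrow> 'm \<Rightarrow> 'm"  (infixr "\<cdot>\<index>" 70)

text \<open>Composition is applicative: \<open>g \<cdot> f\<close> is \<open>f\<close> followed by \<open>g\<close>, and it is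
  unspecified when \<open>Dom g \<noteq> Cod f\<close>.\<close>

definition Hom :: "('o, 'm) cat \<Rightarrow> 'o \<Rightarrow> 'o \<Rightarrow> 'm set" where
  "Hom C A B = {f \<in> Arr C. Dom C f = A \<and> Cod C f = B}"

locale category =
  fixes C :: "('o, 'm) cat" (structure)
  assumes Dom_Obj: "f \<in> Arr C \<Longrightarrow> Dom C f \<in> Obj C"
    and Cod_Obj: "f \<in> Arr C \<Longrightarrow> Cod C f \<in> Obj C"
    and Ident_Hom: "A \<in> Obj C \<Longrightarrow> Ident C A \<in> Hom C A A"
    and Comp_Hom: "\<lbrakk>f \<in> Hom C X Y; g \<in> Hom C Y Z\<rbrakk> \<Longrightarrow> g \<cdot> f \<in> Hom C X Z"
    and Comp_Ident_right: "f \<in> Hom C X Y \<Longrightarrow> f \<cdot> Ident C X = f"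
    and Comp_Ident_left: "f \<in> Hom C X Y \<Longrightarrow> Ident C Y \<cdot> f = f"
    and Comp_assoc: "\<lbrakk>f \<in> Hom C W X; g \<in> Hom C X Y; h \<in> Hom C Y Z\<rbrakk>
      \<Longrightarrow> (h \<cdot> g) \<cdot> f = h \<cdot> (g \<cdot> f)"

definition isomorphism :: "('o, 'm) cat \<Rightarrow> 'm \<Rightarrow> bool" where
  "isomorphism C f \<longleftrightarrow> f \<in> Arr C \<and>
    (\<exists>g \<in> Hom C (Cod C f) (Dom C f).
      g \<cdot>\<^bsub>C\<^esub> f = Ident C (Dom C f) \<and> f \<cdot>\<^bsub>C\<^esub> g = Ident C (Cod C f))"

text \<open>Subobjects of an object are represented by monomorphisms into it.\<close>

definition monic :: "('o, 'm) cat \<Rightarrow> 'm \<Rightarrow> bool" where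
  "monic C m \<longleftrightarrow> m \<in> Arr C \<and>
    (\<forall>W. \<forall>u \<in> Hom C W (Dom C m). \<forall>v \<in> Hom C W (Dom C m). m \<cdot>\<^bsub>C\<^esub> u = m \<cdot>\<^bsub>C\<^esub> v \<longrightarrow> u = v)"

definition factors_through :: "('o, 'm) cat \<Rightarrow> 'm \<Rightarrow> 'm \<Rightarrow> bool" where
  "factors_through C f m \<longleftrightarrow> (\<exists>u \<in> Hom C (Dom C f) (Dom C m). f = m \<cdot>\<^bsub>C\<^esub> u)"

definition jointly_strongly_epic :: "('o, 'm) cat \<Rightarrow> 'm \<Rightarrow> 'm \<Rightarrow> bool" where
  "jointly_strongly_epic C f g \<longleftrightarrow> f \<in> Arr C \<and> g \<in> Arr C \<and> Cod C f = Cod C g \<and>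
    (\<forall>m. monic C m \<and> Cod C m = Cod C f \<and> factors_through C f m \<and> factors_through C g m
      \<longrightarrow> isomorphism C m)"


section \<open>Limits and colimits\<close>

definition is_terminal :: "('o, 'm) cat \<Rightarrow> 'o \<Rightarrow> bool" where
  "is_terminal C T \<longleftrightarrow> T \<in> Obj C \<and> (\<forall>A \<in> Obj C. \<exists>!f. f \<in> Hom C A T)"

definition is_initial :: "('o, 'm) cat \<Rightarrow> 'o \<Rightarrow> bool" where
  "is_initial C I \<longleftrightarrow> I \<in> Obj C \<and> (\<forall>A \<in> Obj C. \<exists>!f. f \<in> Hom C I A)"

definition is_zero_object :: "('o, 'm) cat \<Rightarrow> 'o \<Rightarrow> bool" where
  "is_zero_object C Z \<longleftrightarrow> is_initial C Z \<and> is_terminal C Z"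

definition is_product :: "('o, 'm) cat \<Rightarrow> 'o \<Rightarrow> 'o \<Rightarrow> 'o \<Rightarrow> 'm \<Rightarrow> 'm \<Rightarrow> bool" where
  "is_product C A B P p q \<longleftrightarrow> P \<in> Obj C \<and> p \<in> Hom C P A \<and> q \<in> Hom C P B \<and>
    (\<forall>W. \<forall>f \<in> Hom C W A. \<forall>g \<in> Hom C W B. \<exists>!u. u \<in> Hom C W P \<and> p \<cdot>\<^bsub>C\<^esub> u = f \<and> q \<cdot>\<^bsub>C\<^esub> u = g)"

definition is_coproduct :: "('o, 'm) cat \<Rightarrow> 'o \<Rightarrow> 'o \<Rightarrow> 'o \<Rightarrow> 'm \<Rightarrow> 'm \<Rightarrow> bool" where
  "is_coproduct C A B S i j \<longleftrightarrow> S \<in> Obj C \<and> i \<in> Hom C A S \<and> j \<in> Hom C B S \<and>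
    (\<forall>W. \<forall>f \<in> Hom C A W. \<forall>g \<in> Hom C B W. \<exists>!u. u \<in> Hom C S W \<and> u \<cdot>\<^bsub>C\<^esub> i = f \<and> u \<cdot>\<^bsub>C\<^esub> j = g)"

definition parallel :: "('o, 'm) cat \<Rightarrow> 'm \<Rightarrow> 'm \<Rightarrow> bool" where
  "parallel C f g \<longleftrightarrow> f \<in> Arr C \<and> g \<in> Arr C \<and> Dom C f = Dom C g \<and> Cod C f = Cod C g"

definition is_equalizer :: "('o, 'm) cat \<Rightarrow> 'm \<Rightarrow> 'm \<Rightarrow> 'm \<Rightarrow> bool" where
  "is_equalizer C f g e \<longleftrightarrow> parallel C f g \<and>
    e \<in> Arr C \<and> Cod C e = Dom C f \<and> f \<cdot>\<^bsub>C\<^esub> e = g \<cdot>\<^bsub>C\<^esub> e \<and>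
    (\<forall>W. \<forall>x \<in> Hom C W (Dom C f). f \<cdot>\<^bsub>C\<^esub> x = g \<cdot>\<^bsub>C\<^esub> x \<longrightarrow>
      (\<exists>!u. u \<in> Hom C W (Dom C e) \<and> e \<cdot>\<^bsub>C\<^esub> u = x))"

definition is_coequalizer :: "('o, 'm) cat \<Rightarrow> 'm \<Rightarrow> 'm \<Rightarrow> 'm \<Rightarrow> bool" where
  "is_coequalizer C f g e \<longleftrightarrow> parallel C f g \<and>
    e \<in> Arr C \<and> Dom C e = Cod C f \<and> e \<cdot>\<^bsub>C\<^esub> f = e \<cdot>\<^bsub>C\<^esub> g \<and>
    (\<forall>W. \<forall>x \<in> Hom C (Cod C f) W. x \<cdot>\<^bsub>C\<^esub> f = x \<cdot>\<^bsub>C\<^esub> g \<longrightarrow>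
      (\<exists>!u. u \<in> Hom C (Cod C e) W \<and> u \<cdot>\<^bsub>C\<^esub> e = x))"

text \<open>\<open>p\<close> and \<open>q\<close> are the projections of a pullback to the domains of \<open>f\<close> and \<open>g\<close>.\<close>

definition is_pullback :: "('o, 'm) cat \<Rightarrow> 'm \<Rightarrow> 'm \<Rightarrow> 'm \<Rightarrow> 'm \<Rightarrow> bool" where
  "is_pullback C f g p q \<longleftrightarrow> f \<in> Arr C \<and> g \<in> Arr C \<and> Cod C f = Cod C g \<and>
    p \<in> Arr C \<and> q \<in> Arr C \<and> Dom C p = Dom C q \<and> Cod C p = Dom C f \<and> Cod C q = Dom C g \<and>
    f \<cdot>\<^bsub>C\<^esub> p = g \<cdot>\<^bsub>C\<^esub> q \<and>
    (\<forall>W. \<forall>x \<in> Hom C W (Dom C f). \<forall>y \<in> Hom C W (Dom C g). f \<cdot>\<^bsub>C\<^esub> x = g \<cdot>\<^bsub>C\<^esub> y \<longrightarrow>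
      (\<exists>!u. u \<in> Hom C W (Dom C p) \<and> p \<cdot>\<^bsub>C\<^esub> u = x \<and> q \<cdot>\<^bsub>C\<^esub> u = y))"

definition is_kernel_pair :: "('o, 'm) cat \<Rightarrow> 'm \<Rightarrow> 'm \<Rightarrow> 'm \<Rightarrow> bool" where
  "is_kernel_pair C f p q \<longleftrightarrow> is_pullback C f f p q"

definition regular_epi :: "('o, 'm) cat \<Rightarrow> 'm \<Rightarrow> bool" where
  "regular_epi C e \<longleftrightarrow> (\<exists>f g. is_coequalizer C f g e)"

text \<open>Finite limits are finite products together with equalizers.\<close>

definition has_finite_limits :: "('o, 'm) cat \<Rightarrow> bool" where
  "has_finite_limits C \<longleftrightarrow> (\<exists>T. is_terminal C T) \<and>
    (\<forall>A \<in> Obj C. \<forall>B \<in> Obj C. \<exists>P p q. is_product C A B P p q) \<and>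
    (\<forall>f g. parallel C f g \<longrightarrow> (\<exists>e. is_equalizer C f g e))"

definition has_finite_coproducts :: "('o, 'm) cat \<Rightarrow> bool" where
  "has_finite_coproducts C \<longleftrightarrow> (\<exists>I. is_initial C I) \<and>
    (\<forall>A \<in> Obj C. \<forall>B \<in> Obj C. \<exists>S i j. is_coproduct C A B S i j)"

text \<open>Limits and colimits are unique only up to isomorphism; the following operations
  choose one of each kind.\<close>

definition prod_choice :: "('o, 'm) cat \<Rightarrow> 'o \<Rightarrow> 'o \<Rightarrow> 'o \<times> 'm \<times> 'm" where
  "prod_choice C A B = (SOME (P, p, q). is_product C A B P p q)"

definition prod_obj :: "('o, 'm) cat \<Rightarrow> 'o \<Rightarrow> 'o \<Rightarrow> 'o" where
  "prod_obj C A B = fst (prod_choice C A B)"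

definition proj1 :: "('o, 'm) cat \<Rightarrow> 'o \<Rightarrow> 'o \<Rightarrow> 'm" where
  "proj1 C A B = fst (snd (prod_choice C A B))"

definition proj2 :: "('o, 'm) cat \<Rightarrow> 'o \<Rightarrow> 'o \<Rightarrow> 'm" where
  "proj2 C A B = snd (snd (prod_choice C A B))"

definition pairing :: "('o, 'm) cat \<Rightarrow> 'm \<Rightarrow> 'm \<Rightarrow> 'm" where
  "pairing C f g = (THE u. u \<in> Hom C (Dom C f) (prod_obj C (Cod C f) (Cod C g)) \<and>
    proj1 C (Cod C f) (Cod C g) \<cdot>\<^bsub>C\<^esub> u = f \<and> proj2 C (Cod C f) (Cod C g) \<cdot>\<^bsub>C\<^esub> u = g)"

definition coprod_choice :: "('o, 'm) cat \<Rightarrow> 'o \<Rightarrow> 'o \<Rightarrow> 'o \<times> 'm \<times> 'm" where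
  "coprod_choice C A B = (SOME (S, i, j). is_coproduct C A B S i j)"

definition coprod_obj :: "('o, 'm) cat \<Rightarrow> 'o \<Rightarrow> 'o \<Rightarrow> 'o" where
  "coprod_obj C A B = fst (coprod_choice C A B)"

definition inj1 :: "('o, 'm) cat \<Rightarrow> 'o \<Rightarrow> 'o \<Rightarrow> 'm" where
  "inj1 C A B = fst (snd (coprod_choice C A B))"

definition inj2 :: "('o, 'm) cat \<Rightarrow> 'o \<Rightarrow> 'o \<Rightarrow> 'm" where
  "inj2 C A B = snd (snd (coprod_choice C A B))"

definition copairing :: "('o, 'm) cat \<Rightarrow> 'm \<Rightarrow> 'm \<Rightarrow> 'm" where
  "copairing C f g = (THE u. u \<in> Hom C (coprod_obj C (Dom C f) (Dom C g)) (Cod C f) \<and>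
    u \<cdot>\<^bsub>C\<^esub> inj1 C (Dom C f) (Dom C g) = f \<and> u \<cdot>\<^bsub>C\<^esub> inj2 C (Dom C f) (Dom C g) = g)"

definition pullback_choice :: "('o, 'm) cat \<Rightarrow> 'm \<Rightarrow> 'm \<Rightarrow> 'm \<times> 'm" where
  "pullback_choice C f g = (SOME (p, q). is_pullback C f g p q)"

definition zero_arr :: "('o, 'm) cat \<Rightarrow> 'o \<Rightarrow> 'o \<Rightarrow> 'm" where
  "zero_arr C A B =
    (THE f. \<exists>Z. is_zero_object C Z \<and> (\<exists>u \<in> Hom C A Z. \<exists>v \<in> Hom C Z B. f = v \<cdot>\<^bsub>C\<^esub> u))"

definition is_kernel :: "('o, 'm) cat \<Rightarrow> 'm \<Rightarrow> 'm \<Rightarrow> bool" where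
  "is_kernel C f k \<longleftrightarrow> is_equalizer C f (zero_arr C (Dom C f) (Cod C f)) k"

definition ker :: "('o, 'm) cat \<Rightarrow> 'm \<Rightarrow> 'm" where
  "ker C f = (SOME k. is_kernel C f k)"

definition Ker :: "('o, 'm) cat \<Rightarrow> 'm \<Rightarrow> 'o" where
  "Ker C f = Dom C (ker C f)"


section \<open>Functors and monads\<close>

record ('o, 'm, 'p, 'n) func =
  FObj :: "'o \<Rightarrow> 'p"
  FArr :: "'m \<Rightarrow> 'n"

definition reflects_isos :: "('o, 'm) cat \<Rightarrow> ('p, 'n) cat \<Rightarrow> ('o, 'm, 'p, 'n) func \<Rightarrow> bool" where
  "reflects_isos C D F \<longleftrightarrow> (\<forall>f \<in> Arr C. isomorphism D (FArr F f) \<longrightarrow> isomorphism C f)"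

definition preserves_jointly_strongly_epic ::
    "('o, 'm) cat \<Rightarrow> ('p, 'n) cat \<Rightarrow> ('o, 'm, 'p, 'n) func \<Rightarrow> bool" where
  "preserves_jointly_strongly_epic C D F \<longleftrightarrow>
    (\<forall>f g. jointly_strongly_epic C f g \<longrightarrow> jointly_strongly_epic D (FArr F f) (FArr F g))"

record ('o, 'm) mnd =
  TObj :: "'o \<Rightarrow> 'o"
  TArr :: "'m \<Rightarrow> 'm"
  unit_mnd :: "'o \<Rightarrow> 'm"
  mult_mnd :: "'o \<Rightarrow> 'm"

definition is_algebra :: "('o, 'm) cat \<Rightarrow> ('o, 'm) mnd \<Rightarrow> 'o \<Rightarrow> 'm \<Rightarrow> bool" where
  "is_algebra C T X \<xi> \<longleftrightarrow> \<xi> \<in> Hom C (TObj T X) X \<and>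
    \<xi> \<cdot>\<^bsub>C\<^esub> unit_mnd T X = Ident C X \<and>
    \<xi> \<cdot>\<^bsub>C\<^esub> mult_mnd T X = \<xi> \<cdot>\<^bsub>C\<^esub> TArr T \<xi>"

text \<open>The monad of an adjunction with left adjoint \<open>L\<close>, right adjoint \<open>R\<close>, unit \<open>\<eta>\<close> and
  counit \<open>\<epsilon>\<close>.\<close>

definition adjunction_monad ::
    "('o, 'm, 'p, 'n) func \<Rightarrow> ('p, 'n, 'o, 'm) func \<Rightarrow> ('o \<Rightarrow> 'm) \<Rightarrow> ('p \<Rightarrow> 'n) \<Rightarrow> ('o, 'm) mnd" where
  "adjunction_monad L R \<eta> \<epsilon> =
    \<lparr>TObj = (\<lambda>X. FObj R (FObj L X)), TArr = (\<lambda>f. FArr R (FArr L f)),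
     unit_mnd = \<eta>, mult_mnd = (\<lambda>X. FArr R (\<epsilon> (FObj L X)))\<rparr>"


section \<open>Points\<close>

type_synonym ('o, 'm) point = "'o \<times> 'm \<times> 'm"

text \<open>An arrow of the category of points is a triple consisting of its domain, the
  underlying arrow, and its codomain.\<close>

definition Pt :: "('o, 'm) cat \<Rightarrow> 'o \<Rightarrow>
    (('o, 'm) point, ('o, 'm) point \<times> 'm \<times> ('o, 'm) point) cat" where
  "Pt C B =
    \<lparr>Obj = {(A, p, s). p \<in> Hom C A B \<and> s \<in> Hom C B A \<and> p \<cdot>\<^bsub>C\<^esub> s = Ident C B},
     Arr = {((A, p, s), f, (A', p', s')).
        p \<in> Hom C A B \<and> s \<in> Hom C B A \<and> p \<cdot>\<^bsub>C\<^esub> s = Ident C B \<and>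
        p' \<in> Hom C A' B \<and> s' \<in> Hom C B A' \<and> p' \<cdot>\<^bsub>C\<^esub> s' = Ident C B \<and>
        f \<in> Hom C A A' \<and> p' \<cdot>\<^bsub>C\<^esub> f = p \<and> f \<cdot>\<^bsub>C\<^esub> s = s'},
     Dom = (\<lambda>(X, f, Y). X),
     Cod = (\<lambda>(X, f, Y). Y),
     Ident = (\<lambda>X. (X, Ident C (fst X), X)),
     Comp = (\<lambda>(Y, g, Z) (X, f, Y'). (X, g \<cdot>\<^bsub>C\<^esub> f, Z))\<rparr>"

definition base_change_obj :: "('o, 'm) cat \<Rightarrow> 'm \<Rightarrow> ('o, 'm) point \<Rightarrow> ('o, 'm) point" where
  "base_change_obj C v = (\<lambda>(A, p, s). let (p1, p2) = pullback_choice C v p in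
    (Dom C p1, p1,
     THE t. t \<in> Hom C (Dom C v) (Dom C p1) \<and> p1 \<cdot>\<^bsub>C\<^esub> t = Ident C (Dom C v) \<and> p2 \<cdot>\<^bsub>C\<^esub> t = s \<cdot>\<^bsub>C\<^esub> v))"

text \<open>Pulling back along \<open>v : E \<rightarrow> B\<close>, from points over \<open>B\<close> to points over \<open>E\<close>.\<close>

definition base_change :: "('o, 'm) cat \<Rightarrow> 'm \<Rightarrow>
    (('o, 'm) point, ('o, 'm) point \<times> 'm \<times> ('o, 'm) point,
     ('o, 'm) point, ('o, 'm) point \<times> 'm \<times> ('o, 'm) point) func" where
  "base_change C v =
    \<lparr>FObj = base_change_obj C v,
     FArr = (\<lambda>((A, p, s), f, (A', p', s')).
       let (p1, p2) = pullback_choice C v p; (p1', p2') = pullback_choice C v p' in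
       (base_change_obj C v (A, p, s),
        THE g. g \<in> Hom C (Dom C p1) (Dom C p1') \<and> p1' \<cdot>\<^bsub>C\<^esub> g = p1 \<and> p2' \<cdot>\<^bsub>C\<^esub> g = f \<cdot>\<^bsub>C\<^esub> p2,
        base_change_obj C v (A', p', s')))\<rparr>"


section \<open>Semi-abelian categories\<close>

text \<open>Regular in the sense of Barr.\<close>

locale regular_category = category C for C :: "('o, 'm) cat" (structure) +
  assumes finite_limits: "has_finite_limits C"
    and kernel_pair_coequalizer:
      "is_kernel_pair C f p q \<Longrightarrow> \<exists>e. is_coequalizer C p q e"
    and regular_epi_pullback:
      "\<lbrakk>regular_epi C e; is_pullback C f e p q\<rbrakk> \<Longrightarrow> regular_epi C p"

definition is_equivalence_relation :: "('o, 'm) cat \<Rightarrow> 'o \<Rightarrow> 'o \<Rightarrow> 'm \<Rightarrow> 'm \<Rightarrow> bool" where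
  "is_equivalence_relation C R X r1 r2 \<longleftrightarrow> r1 \<in> Hom C R X \<and> r2 \<in> Hom C R X \<and>
    (\<forall>W. \<forall>u \<in> Hom C W R. \<forall>v \<in> Hom C W R.
      r1 \<cdot>\<^bsub>C\<^esub> u = r1 \<cdot>\<^bsub>C\<^esub> v \<and> r2 \<cdot>\<^bsub>C\<^esub> u = r2 \<cdot>\<^bsub>C\<^esub> v \<longrightarrow> u = v) \<and>
    (\<exists>d \<in> Hom C X R. r1 \<cdot>\<^bsub>C\<^esub> d = Ident C X \<and> r2 \<cdot>\<^bsub>C\<^esub> d = Ident C X) \<and>
    (\<exists>s \<in> Hom C R R. r1 \<cdot>\<^bsub>C\<^esub> s = r2 \<and> r2 \<cdot>\<^bsub>C\<^esub> s = r1) \<and>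
    (\<forall>p q. is_pullback C r2 r1 p q \<longrightarrow>
      (\<exists>t \<in> Hom C (Dom C p) R. r1 \<cdot>\<^bsub>C\<^esub> t = r1 \<cdot>\<^bsub>C\<^esub> p \<and> r2 \<cdot>\<^bsub>C\<^esub> t = r2 \<cdot>\<^bsub>C\<^esub> q))"

locale exact_category = regular_category C for C :: "('o, 'm) cat" (structure) +
  assumes equivalence_relation_effective:
    "is_equivalence_relation C R X r1 r2 \<Longrightarrow> \<exists>f. is_kernel_pair C f r1 r2"

text \<open>Protomodular in the sense of Bourn.\<close>

definition protomodular :: "('o, 'm) cat \<Rightarrow> bool" where
  "protomodular C \<longleftrightarrow>
    (\<forall>v \<in> Arr C. reflects_isos (Pt C (Cod C v)) (Pt C (Dom C v)) (base_change C v))"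

locale semi_abelian = exact_category C for C :: "('o, 'm) cat" (structure) +
  assumes pointed: "\<exists>Z. is_zero_object C Z"
    and finite_coproducts: "has_finite_coproducts C"
    and protomodular: "protomodular C"


section \<open>Internal actions\<close>

definition Ker_functor :: "('o, 'm) cat \<Rightarrow> 'o \<Rightarrow>
    (('o, 'm) point, ('o, 'm) point \<times> 'm \<times> ('o, 'm) point, 'o, 'm) func" where
  "Ker_functor C B =
    \<lparr>FObj = (\<lambda>(A, p, s). Ker C p),
     FArr = (\<lambda>((A, p, s), f, (A', p', s')).
       THE g. g \<in> Hom C (Ker C p) (Ker C p') \<and> ker C p' \<cdot>\<^bsub>C\<^esub> g = f \<cdot>\<^bsub>C\<^esub> ker C p)\<rparr>"

definition plus_obj :: "('o, 'm) cat \<Rightarrow> 'o \<Rightarrow> 'o \<Rightarrow> ('o, 'm) point" where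
  "plus_obj C B X =
    (coprod_obj C B X, copairing C (Ident C B) (zero_arr C X B), inj1 C B X)"

definition plus_functor :: "('o, 'm) cat \<Rightarrow> 'o \<Rightarrow>
    ('o, 'm, ('o, 'm) point, ('o, 'm) point \<times> 'm \<times> ('o, 'm) point) func" where
  "plus_functor C B =
    \<lparr>FObj = plus_obj C B,
     FArr = (\<lambda>f. (plus_obj C B (Dom C f),
       copairing C (inj1 C B (Cod C f)) (inj2 C B (Cod C f) \<cdot>\<^bsub>C\<^esub> f),
       plus_obj C B (Cod C f)))\<rparr>"

text \<open>Unit and counit of the adjunction between \<open>plus_functor C B\<close> (left) and
  \<open>Ker_functor C B\<close> (right): the unit at \<open>X\<close> is the factorization of the injection
  \<open>X \<rightarrow> B + X\<close> through the kernel of \<open>[1, 0]\<close>, and the counit at \<open>(A, p, s)\<close> is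
  \<open>[s, ker p] : B + Ker p \<rightarrow> A\<close>.\<close>

definition plus_Ker_unit :: "('o, 'm) cat \<Rightarrow> 'o \<Rightarrow> 'o \<Rightarrow> 'm" where
  "plus_Ker_unit C B X =
    (let p = copairing C (Ident C B) (zero_arr C X B) in
      THE u. u \<in> Hom C X (Ker C p) \<and> ker C p \<cdot>\<^bsub>C\<^esub> u = inj2 C B X)"

definition plus_Ker_counit :: "('o, 'm) cat \<Rightarrow> 'o \<Rightarrow> ('o, 'm) point \<Rightarrow>
    ('o, 'm) point \<times> 'm \<times> ('o, 'm) point" where
  "plus_Ker_counit C B =
    (\<lambda>(A, p, s). (plus_obj C B (Ker C p), copairing C s (ker C p), (A, p, s)))"

text \<open>The monad written \<open>B \<flat> (-)\<close>, with \<open>B \<flat> X\<close> the kernel of \<open>[1, 0] : B + X \<rightarrow> B\<close>.\<close>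

definition flat_monad :: "('o, 'm) cat \<Rightarrow> 'o \<Rightarrow> ('o, 'm) mnd" where
  "flat_monad C B = adjunction_monad (plus_functor C B) (Ker_functor C B)
    (plus_Ker_unit C B) (plus_Ker_counit C B)"

definition is_action :: "('o, 'm) cat \<Rightarrow> 'o \<Rightarrow> 'o \<Rightarrow> 'm \<Rightarrow> bool" where
  "is_action C B X \<xi> \<longleftrightarrow> is_algebra C (flat_monad C B) X \<xi>"

definition characteristic :: "('o, 'm) cat \<Rightarrow> 'o \<Rightarrow> 'm \<Rightarrow> bool" where
  "characteristic C G h \<longleftrightarrow> monic C h \<and> Cod C h = G \<and>
    (\<forall>B \<in> Obj C. \<forall>\<xi>. is_action C B G \<xi> \<longrightarrow>
      (\<exists>!\<xi>'. is_action C B (Dom C h) \<xi>' \<and> h \<cdot>\<^bsub>C\<^esub> \<xi>' = \<xi> \<cdot>\<^bsub>C\<^esub> TArr (flat_monad C B) h))"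


section \<open>Higgins commutators\<close>

definition is_regular_image :: "('o, 'm) cat \<Rightarrow> 'm \<Rightarrow> 'm \<Rightarrow> bool" where
  "is_regular_image C f m \<longleftrightarrow> monic C m \<and>
    (\<exists>e. regular_epi C e \<and> Cod C e = Dom C m \<and> f = m \<cdot>\<^bsub>C\<^esub> e)"

definition regular_image :: "('o, 'm) cat \<Rightarrow> 'm \<Rightarrow> 'm" where
  "regular_image C f = (SOME m. is_regular_image C f m)"

text \<open>The canonical arrow \<open>\<Sigma> : H + K \<rightarrow> H \<times> K\<close>.\<close>

definition sum_to_prod :: "('o, 'm) cat \<Rightarrow> 'o \<Rightarrow> 'o \<Rightarrow> 'm" where
  "sum_to_prod C H K =
    pairing C (copairing C (Ident C H) (zero_arr C K H)) (copairing C (zero_arr C H K) (Ident C K))"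

definition higgins_commutator :: "('o, 'm) cat \<Rightarrow> 'm \<Rightarrow> 'm \<Rightarrow> 'm" where
  "higgins_commutator C h k =
    regular_image C (copairing C h k \<cdot>\<^bsub>C\<^esub> ker C (sum_to_prod C (Dom C h) (Dom C k)))"

end

theory Submission
  imports Defs
begin

text \<open>A subobject \<open>m : M \<rightarrow> G\<close> is characteristic as soon as \<open>\<xi> (B \<flat> m)\<close> factors through \<open>m\<close> for
  every action \<open>\<xi>\<close> of \<open>B\<close> on \<open>G\<close>: the algebra laws are then inherited because \<open>m\<close> is monic. Let
  \<open>\<sigma> : H \<diamondop> K \<rightarrow> H + K\<close> be the kernel of \<open>\<Sigma>\<close> and \<open>[h, k] \<sigma> = m e\<close> the image factorization defining
  \<open>[H, K]\<close>. The points \<open>B + H\<close> and \<open>B + K\<close> are jointly strongly epic in \<open>B + (H + K)\<close>, so by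
  hypothesis \<open>B \<flat> H + B \<flat> K \<rightarrow> B \<flat> (H + K)\<close> is a regular epimorphism. Both sides map to
  \<open>B \<flat> H \<times> B \<flat> K\<close>, and restricting to kernels gives a regular epimorphism
  \<open>g : (B \<flat> H) \<diamondop> (B \<flat> K) \<rightarrow> N\<close> onto the kernel \<open>N\<close> of \<open>B \<flat> (H + K) \<rightarrow> B \<flat> H \<times> B \<flat> K\<close>, through
  which \<open>B \<flat> \<sigma>\<close> factors. As \<open>\<xi>\<close> restricts to \<open>H\<close> and \<open>K\<close>,
  the arrow \<open>N \<rightarrow> B \<flat> (H + K) \<rightarrow> B \<flat> G \<rightarrow> G\<close> factors through \<open>m\<close> after composition with \<open>g\<close>, hence
  factors through \<open>m\<close>; so does \<open>\<xi> (B \<flat> m) (B \<flat> e)\<close>, and \<open>B \<flat> e\<close> is again a regular epimorphism.\<close>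

section \<open>Regular categories\<close>

context category
begin

section \<open>Composition, monomorphisms and factorizations\<close>

lemma comp_Arr: "\<lbrakk>f \<in> Arr C; g \<in> Arr C; Cod C f = Dom C g\<rbrakk> \<Longrightarrow> g \<cdot> f \<in> Arr C"
  and comp_Dom: "\<lbrakk>f \<in> Arr C; g \<in> Arr C; Cod C f = Dom C g\<rbrakk> \<Longrightarrow> Dom C (g \<cdot> f) = Dom C f"
  and comp_Cod: "\<lbrakk>f \<in> Arr C; g \<in> Arr C; Cod C f = Dom C g\<rbrakk> \<Longrightarrow> Cod C (g \<cdot> f) = Cod C g"
  using Comp_Hom[of f "Dom C f" "Cod C f" g "Cod C g"] by (auto simp: Hom_def)

lemma comp_assoc:
  "\<lbrakk>f \<in> Arr C; g \<in> Arr C; h \<in> Arr C; Cod C f = Dom C g; Cod C g = Dom C h\<rbrakk>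
    \<Longrightarrow> (h \<cdot> g) \<cdot> f = h \<cdot> (g \<cdot> f)"
  using Comp_assoc[of f "Dom C f" "Cod C f" g "Cod C g" h "Cod C h"] by (auto simp: Hom_def)

lemma Ident_simps:
  "A \<in> Obj C \<Longrightarrow> Ident C A \<in> Arr C"
  "A \<in> Obj C \<Longrightarrow> Dom C (Ident C A) = A"
  "A \<in> Obj C \<Longrightarrow> Cod C (Ident C A) = A"
  "\<lbrakk>f \<in> Arr C; Dom C f = A\<rbrakk> \<Longrightarrow> f \<cdot> Ident C A = f"
  "\<lbrakk>f \<in> Arr C; Cod C f = A\<rbrakk> \<Longrightarrow> Ident C A \<cdot> f = f"
  using Ident_Hom[of A] Comp_Ident_right[of f "Dom C f" "Cod C f"]
    Comp_Ident_left[of f "Dom C f" "Cod C f"]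
  by (auto simp: Hom_def)

text \<open>Once composites are normalised to the right, an equation \<open>g \<cdot> f = x\<close>
  no longer matches inside a longer composite. This is its form with a tail
  \<open>z\<close>.\<close>

lemma comp_extend:
  assumes "f \<in> Hom C X Y" "g \<in> Hom C Y Z" "g \<cdot> f = x" "z \<in> Arr C" "Cod C z = X"
  shows "g \<cdot> (f \<cdot> z) = x \<cdot> z"
  using assms by (auto simp: Hom_def comp_assoc)

lemmas comp_simps = Hom_def comp_Arr comp_Dom comp_Cod comp_assoc Ident_simps Dom_Obj Cod_Obj

lemma Hom_Obj: "f \<in> Hom C A B \<Longrightarrow> A \<in> Obj C" "f \<in> Hom C A B \<Longrightarrow> B \<in> Obj C"
  by (auto simp: Hom_def Dom_Obj Cod_Obj)

lemma monicD:
  assumes "monic C m" "u \<in> Hom C W (Dom C m)" "v \<in> Hom C W (Dom C m)" "m \<cdot> u = m \<cdot> v"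
  shows "u = v"
  using assms unfolding monic_def by blast

lemma factors_throughI:
  assumes "u \<in> Hom C W A" "m \<in> Hom C A X" "f = m \<cdot> u"
  shows "factors_through C f m"
  unfolding factors_through_def
  using assms by (intro bexI[of _ u]) (auto simp: comp_simps)

section \<open>Regular epimorphisms\<close>

lemma regular_epi_Arr: "regular_epi C e \<Longrightarrow> e \<in> Arr C"
  by (auto simp: regular_epi_def is_coequalizer_def)

text \<open>Both \<open>u\<close> and \<open>v\<close> factor the same arrow
  \<open>u \<cdot> e\<close>, which equalizes the pair \<open>f\<close>, \<open>g\<close> on the
  right; such a factorization is unique.\<close>

lemma coequalizer_epi:
  assumes e: "is_coequalizer C f g e" and u: "u \<in> Hom C (Cod C e) W" and v: "v \<in> Hom C (Cod C e) W"
    and eq: "u \<cdot> e = v \<cdot> e"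
  shows "u = v"
proof -
  have "u \<cdot> e \<in> Hom C (Cod C f) W" "(u \<cdot> e) \<cdot> f = (u \<cdot> e) \<cdot> g"
    using e u by (auto simp: is_coequalizer_def parallel_def comp_simps)
  then have "\<exists>!w. w \<in> Hom C (Cod C e) W \<and> w \<cdot> e = u \<cdot> e"
    using e unfolding is_coequalizer_def by blast
  then show ?thesis using u v eq by metis
qed

lemma regular_epi_epi:
  assumes "regular_epi C e" "u \<in> Hom C (Cod C e) W" "v \<in> Hom C (Cod C e) W" "u \<cdot> e = v \<cdot> e"
  shows "u = v"
  using assms coequalizer_epi unfolding regular_epi_def by blast

text \<open>If \<open>e\<close> is the coequalizer of \<open>f\<close> and \<open>g\<close>, then
  \<open>m \<cdot> b\<close> takes equal values on them because it equals
  \<open>y \<cdot> e\<close>. Cancelling \<open>m\<close>, so does \<open>b\<close>, which therefore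
  descends to an arrow \<open>d\<close>; cancelling \<open>e\<close> gives the claim. In this form a
  factorization through a subobject is descended along a regular epimorphism.\<close>

lemma regular_epi_diagonal:
  assumes e: "regular_epi C e" and m: "monic C m" and y: "y \<in> Hom C (Cod C e) (Cod C m)"
    and b: "b \<in> Hom C (Dom C e) (Dom C m)" and eq: "y \<cdot> e = m \<cdot> b"
  shows "\<exists>d \<in> Hom C (Cod C e) (Dom C m). y = m \<cdot> d"
proof -
  obtain f g where fg: "is_coequalizer C f g e"
    using e by (auto simp: regular_epi_def)
  have mA: "m \<in> Arr C" using m by (simp add: monic_def)
  have "m \<cdot> (b \<cdot> f) = (m \<cdot> b) \<cdot> f" "m \<cdot> (b \<cdot> g) = (m \<cdot> b) \<cdot> g"
    using fg mA b by (auto simp: is_coequalizer_def parallel_def comp_simps)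
  moreover have "(m \<cdot> b) \<cdot> f = (m \<cdot> b) \<cdot> g"
    using fg y by (auto simp: is_coequalizer_def parallel_def comp_simps eq[symmetric])
  ultimately have "m \<cdot> (b \<cdot> f) = m \<cdot> (b \<cdot> g)" by simp
  then have "b \<cdot> f = b \<cdot> g"
    using monicD[OF m, of "b \<cdot> f" "Dom C f" "b \<cdot> g"] fg b
    by (auto simp: is_coequalizer_def parallel_def comp_simps)
  moreover have "b \<in> Hom C (Cod C f) (Dom C m)"
    using fg b by (auto simp: is_coequalizer_def)
  ultimately obtain d where d: "d \<in> Hom C (Cod C e) (Dom C m)" "d \<cdot> e = b"
    using fg unfolding is_coequalizer_def by metis
  have "y = m \<cdot> d"
  proof (rule coequalizer_epi[OF fg y])
    show "m \<cdot> d \<in> Hom C (Cod C e) (Cod C m)" using d mA by (auto simp: comp_simps)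
    show "y \<cdot> e = (m \<cdot> d) \<cdot> e"
      using d mA fg by (auto simp: eq comp_simps is_coequalizer_def)
  qed
  then show ?thesis using d by blast
qed

text \<open>The composite is a coequalizer of the same pair as \<open>e\<close>; comparison arrows
  are transported along the inverse \<open>n\<close> of \<open>m\<close>.\<close>

lemma isomorphism_comp_regular_epi:
  assumes e: "regular_epi C e" and m: "isomorphism C m" and dom: "Dom C m = Cod C e"
  shows "regular_epi C (m \<cdot> e)"
proof -
  obtain f g where fg: "is_coequalizer C f g e"
    using e by (auto simp: regular_epi_def)
  have mA: "m \<in> Arr C" using m by (simp add: isomorphism_def)
  obtain n where n: "n \<in> Hom C (Cod C m) (Dom C m)" "n \<cdot> m = Ident C (Dom C m)" "m \<cdot> n = Ident C (Cod C m)"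
    using m by (auto simp: isomorphism_def)
  have eA: "e \<in> Arr C" "Dom C e = Cod C f" and par: "parallel C f g" and ef: "e \<cdot> f = e \<cdot> g"
    using fg by (auto simp: is_coequalizer_def)
  have "is_coequalizer C f g (m \<cdot> e)"
    unfolding is_coequalizer_def
  proof (intro conjI allI ballI impI)
    show "parallel C f g" by (rule par)
    show "m \<cdot> e \<in> Arr C" "Dom C (m \<cdot> e) = Cod C f" using mA eA dom by (simp_all add: comp_simps)
    show "(m \<cdot> e) \<cdot> f = (m \<cdot> e) \<cdot> g"
      using mA eA dom par ef by (simp add: comp_simps parallel_def)
    fix W x assume x: "x \<in> Hom C (Cod C f) W" "x \<cdot> f = x \<cdot> g"
    then obtain u where u: "u \<in> Hom C (Cod C e) W" "u \<cdot> e = x"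
      using fg unfolding is_coequalizer_def by metis
    have nm: "n \<cdot> (m \<cdot> e) = e"
      using n mA eA dom by (auto simp: comp_simps comp_assoc[symmetric])
    show "\<exists>!u. u \<in> Hom C (Cod C (m \<cdot> e)) W \<and> u \<cdot> (m \<cdot> e) = x"
    proof (rule ex1I[of _ "u \<cdot> n"], intro conjI)
      show "u \<cdot> n \<in> Hom C (Cod C (m \<cdot> e)) W" using u n mA eA dom by (auto simp: comp_simps)
      show "(u \<cdot> n) \<cdot> (m \<cdot> e) = x" using u n mA eA dom nm by (auto simp: comp_simps)
      fix v assume v: "v \<in> Hom C (Cod C (m \<cdot> e)) W \<and> v \<cdot> (m \<cdot> e) = x"
      have vC: "v \<in> Arr C" "Dom C v = Cod C m" "Cod C v = W"
        using v mA eA dom by (auto simp: comp_simps)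
      have "v \<cdot> m = u"
      proof (rule coequalizer_epi[OF fg _ u(1)])
        show "v \<cdot> m \<in> Hom C (Cod C e) W" using vC mA dom by (auto simp: comp_simps)
        show "(v \<cdot> m) \<cdot> e = u \<cdot> e" using v vC mA eA dom u by (auto simp: comp_simps)
      qed
      then have "u \<cdot> n = v \<cdot> (m \<cdot> n)"
        using vC mA n by (auto simp: comp_simps)
      then show "v = u \<cdot> n" using vC n by (simp add: Ident_simps)
    qed
  qed
  then show ?thesis by (auto simp: regular_epi_def)
qed

end

context regular_category
begin

section \<open>Chosen products and pullbacks\<close>

lemma chosen_product:
  assumes "A \<in> Obj C" "B \<in> Obj C"
  shows "is_product C A B (prod_obj C A B) (proj1 C A B) (proj2 C A B)"
proof -
  have "\<exists>x. case x of (P, p, q) \<Rightarrow> is_product C A B P p q"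
    using finite_limits assms by (fastforce simp: has_finite_limits_def)
  from someI_ex[OF this] show ?thesis
    by (simp add: prod_obj_def proj1_def proj2_def prod_choice_def split: prod.splits)
qed

lemma proj_Hom:
  assumes "A \<in> Obj C" "B \<in> Obj C"
  shows "proj1 C A B \<in> Hom C (prod_obj C A B) A" "proj2 C A B \<in> Hom C (prod_obj C A B) B"
  using chosen_product[OF assms] by (auto simp: is_product_def)

lemma product_eqI:
  assumes "A \<in> Obj C" "B \<in> Obj C" "u \<in> Hom C W (prod_obj C A B)" "v \<in> Hom C W (prod_obj C A B)"
    and "proj1 C A B \<cdot> u = proj1 C A B \<cdot> v" "proj2 C A B \<cdot> u = proj2 C A B \<cdot> v"
  shows "u = v"
proof -
  have "proj1 C A B \<cdot> v \<in> Hom C W A" "proj2 C A B \<cdot> v \<in> Hom C W B"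
    using assms Comp_Hom proj_Hom by blast+
  then have "\<exists>!w. w \<in> Hom C W (prod_obj C A B) \<and> proj1 C A B \<cdot> w = proj1 C A B \<cdot> v
      \<and> proj2 C A B \<cdot> w = proj2 C A B \<cdot> v"
    using chosen_product[OF assms(1,2)] unfolding is_product_def by blast
  then show ?thesis using assms by metis
qed

lemma pairing_props:
  assumes f: "f \<in> Hom C W A" and g: "g \<in> Hom C W B"
  shows "pairing C f g \<in> Hom C W (prod_obj C A B)"
    and "proj1 C A B \<cdot> pairing C f g = f" and "proj2 C A B \<cdot> pairing C f g = g"
proof -
  have "\<exists>!u. u \<in> Hom C W (prod_obj C A B) \<and> proj1 C A B \<cdot> u = f \<and> proj2 C A B \<cdot> u = g"
    using chosen_product[OF Hom_Obj(2)[OF f] Hom_Obj(2)[OF g]] f g unfolding is_product_def by blast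
  from theI'[OF this] show "pairing C f g \<in> Hom C W (prod_obj C A B)"
    "proj1 C A B \<cdot> pairing C f g = f" "proj2 C A B \<cdot> pairing C f g = g"
    using f g by (auto simp: pairing_def Hom_def)
qed

text \<open>The equalizer of the two composites out of the product, followed by the projections, is
  a pullback.\<close>

lemma pullback_exists:
  assumes f: "f \<in> Hom C A X" and g: "g \<in> Hom C B X"
  shows "\<exists>p q. is_pullback C f g p q"
proof -
  note O = Hom_Obj[OF f] Hom_Obj[OF g]
  note P = proj_Hom[OF O(1,3)]
  have "parallel C (f \<cdot> proj1 C A B) (g \<cdot> proj2 C A B)"
    using f g P by (auto simp: parallel_def comp_simps)
  then obtain e where e: "is_equalizer C (f \<cdot> proj1 C A B) (g \<cdot> proj2 C A B) e"
    using finite_limits unfolding has_finite_limits_def by blast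
  have eA: "e \<in> Arr C" "Cod C e = prod_obj C A B"
    "(f \<cdot> proj1 C A B) \<cdot> e = (g \<cdot> proj2 C A B) \<cdot> e"
    using e f P by (auto simp: is_equalizer_def comp_simps)
  have "is_pullback C f g (proj1 C A B \<cdot> e) (proj2 C A B \<cdot> e)"
    unfolding is_pullback_def
  proof (intro conjI allI ballI impI)
    fix W x y assume x: "x \<in> Hom C W (Dom C f)" and y: "y \<in> Hom C W (Dom C g)" and xy: "f \<cdot> x = g \<cdot> y"
    have x': "x \<in> Hom C W A" and y': "y \<in> Hom C W B" using x y f g by (auto simp: Hom_def)
    note w = pairing_props[OF x' y']
    have "pairing C x y \<in> Hom C W (Dom C (f \<cdot> proj1 C A B))"
      using w f P by (auto simp: comp_simps)
    moreover have "(f \<cdot> proj1 C A B) \<cdot> pairing C x y = (g \<cdot> proj2 C A B) \<cdot> pairing C x y"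
      using w f g P xy by (auto simp: comp_simps)
    ultimately obtain u where u: "u \<in> Hom C W (Dom C e)" "e \<cdot> u = pairing C x y"
      and uu: "\<And>v. v \<in> Hom C W (Dom C e) \<Longrightarrow> e \<cdot> v = pairing C x y \<Longrightarrow> v = u"
      using e unfolding is_equalizer_def by metis
    have D: "Dom C (proj1 C A B \<cdot> e) = Dom C e" using eA P by (auto simp: comp_simps)
    show "\<exists>!u. u \<in> Hom C W (Dom C (proj1 C A B \<cdot> e)) \<and>
      (proj1 C A B \<cdot> e) \<cdot> u = x \<and> (proj2 C A B \<cdot> e) \<cdot> u = y"
      unfolding D
    proof (rule ex1I[of _ u], intro conjI)
      show "u \<in> Hom C W (Dom C e)" by fact
      show "(proj1 C A B \<cdot> e) \<cdot> u = x" "(proj2 C A B \<cdot> e) \<cdot> u = y"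
        using u eA P w by (auto simp: comp_simps)
      fix v assume v: "v \<in> Hom C W (Dom C e) \<and> (proj1 C A B \<cdot> e) \<cdot> v = x \<and> (proj2 C A B \<cdot> e) \<cdot> v = y"
      then have vA: "v \<in> Hom C W (Dom C e)"
        and vx: "proj1 C A B \<cdot> (e \<cdot> v) = x" "proj2 C A B \<cdot> (e \<cdot> v) = y"
        using eA P by (auto simp: comp_simps)
      have "e \<cdot> v = pairing C x y"
      proof (rule product_eqI[OF O(1,3) _ w(1)])
        show "e \<cdot> v \<in> Hom C W (prod_obj C A B)" using vA eA by (simp add: comp_simps)
      qed (simp_all add: vx w)
      then show "v = u" using uu v by blast
    qed
  qed (use f g P eA in \<open>auto simp: comp_simps\<close>)
  then show ?thesis by blast
qed

text \<open>Pullback stability in the language of generalized elements: an element \<open>u\<close>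
  of the codomain of \<open>e\<close> acquires a preimage \<open>a\<close> after passing to a cover
  \<open>w\<close> of its stage of definition.\<close>

lemma regular_epi_cover:
  assumes e: "regular_epi C e" and u: "u \<in> Hom C W (Cod C e)"
  shows "\<exists>V w a. regular_epi C w \<and> w \<in> Hom C V W \<and> a \<in> Hom C V (Dom C e) \<and> u \<cdot> w = e \<cdot> a"
proof -
  have "e \<in> Hom C (Dom C e) (Cod C e)" using regular_epi_Arr[OF e] by (simp add: Hom_def)
  then obtain p q where pq: "is_pullback C u e p q" using pullback_exists[OF u] by blast
  then have "regular_epi C p" by (rule regular_epi_pullback[OF e])
  moreover have "p \<in> Hom C (Dom C p) W" "q \<in> Hom C (Dom C p) (Dom C e)" "u \<cdot> p = e \<cdot> q"
    using pq u by (auto simp: is_pullback_def Hom_def)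
  ultimately show ?thesis by blast
qed

text \<open>The image is the comparison arrow \<open>m\<close> out of the coequalizer
  \<open>e\<close> of the kernel pair of \<open>f\<close>. The substance is that \<open>m\<close> is
  monic, which is shown by lifting two generalized elements along \<open>e\<close>.\<close>

lemma regular_image_exists:
  assumes f: "f \<in> Arr C"
  shows "\<exists>m. is_regular_image C f m"
proof -
  have fH: "f \<in> Hom C (Dom C f) (Cod C f)" using f by (simp add: Hom_def)
  obtain p q where pq: "is_pullback C f f p q" using pullback_exists[OF fH fH] by blast
  then obtain e where e: "is_coequalizer C p q e"
    using kernel_pair_coequalizer unfolding is_kernel_pair_def by blast
  have pqA: "p \<in> Arr C" "q \<in> Arr C" "Dom C p = Dom C q" "Cod C p = Dom C f" "Cod C q = Dom C f" "f \<cdot> p = f \<cdot> q"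
    using pq by (auto simp: is_pullback_def)
  have eA: "e \<in> Arr C" "Dom C e = Dom C f" "e \<cdot> p = e \<cdot> q"
    using e pqA by (auto simp: is_coequalizer_def)
  have re: "regular_epi C e" using e by (auto simp: regular_epi_def)
  have "f \<in> Hom C (Cod C p) (Cod C f)" using f pqA by (simp add: Hom_def)
  then obtain m where m: "m \<in> Hom C (Cod C e) (Cod C f)" "m \<cdot> e = f"
    using e pqA unfolding is_coequalizer_def by metis
  have "monic C m"
    unfolding monic_def
  proof (intro conjI allI ballI impI)
    show "m \<in> Arr C" using m by (simp add: Hom_def)
    fix W u v assume uv: "u \<in> Hom C W (Dom C m)" "v \<in> Hom C W (Dom C m)" "m \<cdot> u = m \<cdot> v"
    have dm: "Dom C m = Cod C e" using m by (simp add: Hom_def)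
    \<comment> \<open>First \<open>u\<close> is lifted along \<open>e\<close> over \<open>w\<close>,
      then \<open>v \<cdot> w\<close> over a further cover \<open>w'\<close>, so that
      \<open>a \<cdot> w'\<close> and \<open>b\<close> live on the same stage
      \<open>V'\<close>.\<close>
    obtain V w a where w: "regular_epi C w" "w \<in> Hom C V W" "a \<in> Hom C V (Dom C e)" "u \<cdot> w = e \<cdot> a"
      using regular_epi_cover[OF re] uv dm by metis
    have "v \<cdot> w \<in> Hom C V (Cod C e)" using Comp_Hom w uv dm by metis
    then obtain V' w' b where w': "regular_epi C w'" "w' \<in> Hom C V' V" "b \<in> Hom C V' (Dom C e)"
        "(v \<cdot> w) \<cdot> w' = e \<cdot> b"
      using regular_epi_cover[OF re] by metis
    have eH: "e \<in> Hom C (Dom C e) (Cod C e)" using eA by (simp add: Hom_def)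
    note me = comp_extend[OF eH m]
    have "f \<cdot> (a \<cdot> w') = m \<cdot> ((e \<cdot> a) \<cdot> w')"
      using me m(1) eA(1) w(2,3) w'(2) by (auto simp: comp_simps)
    also have "\<dots> = (m \<cdot> u) \<cdot> (w \<cdot> w')"
      unfolding w(4)[symmetric] using m(1) w(2) w'(2) uv(1,2) by (auto simp: comp_simps)
    also have "\<dots> = m \<cdot> ((v \<cdot> w) \<cdot> w')"
      unfolding uv(3) using m(1) w(2) w'(2) uv(1,2) by (auto simp: comp_simps)
    also have "\<dots> = f \<cdot> b"
      unfolding w'(4) using me w'(3) by (auto simp: Hom_def)
    finally have "f \<cdot> (a \<cdot> w') = f \<cdot> b" .
    moreover have "a \<cdot> w' \<in> Hom C V' (Dom C f)" "b \<in> Hom C V' (Dom C f)"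
      using w(2,3) w'(2,3) eA(2) by (auto simp: comp_simps)
    \<comment> \<open>Two elements identified by \<open>f\<close> form an element \<open>t\<close>
      of its kernel pair, and \<open>e\<close> identifies the two legs. The covers \<open>w'\<close>
      and \<open>w\<close> are then cancelled, being epimorphisms.\<close>
    ultimately obtain t where t: "t \<in> Hom C V' (Dom C p)" "p \<cdot> t = a \<cdot> w'" "q \<cdot> t = b"
      using pq unfolding is_pullback_def by metis
    have "(u \<cdot> w) \<cdot> w' = (e \<cdot> p) \<cdot> t"
      unfolding w(4) using w(3) w'(2) eA(1,2) t(1,2) pqA(1,4) by (auto simp: comp_simps)
    also have "\<dots> = (v \<cdot> w) \<cdot> w'"
      unfolding w'(4) eA(3) using eA(1,2) t(1,3) pqA(2,3,5) by (auto simp: comp_simps)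
    finally have "u \<cdot> w = v \<cdot> w"
      using w(2) w'(2) uv(1,2)
      by (intro regular_epi_epi[OF w'(1), of "u \<cdot> w" "Dom C m"]) (auto simp: comp_simps)
    then show "u = v"
      using w(2) uv(1,2) by (intro regular_epi_epi[OF w(1), of u "Dom C m"]) (auto simp: comp_simps)
  qed
  then show ?thesis
    unfolding is_regular_image_def using re m
    by (intro exI[of _ m] conjI exI[of _ e]) (simp_all add: Hom_def)
qed

lemma regular_image_is_regular_image:
  "f \<in> Arr C \<Longrightarrow> is_regular_image C f (regular_image C f)"
  unfolding regular_image_def by (rule someI_ex[OF regular_image_exists])

end

section \<open>Zero arrows, coproducts and kernels\<close>

locale pointed_regular_category = regular_category +
  assumes zero_object: "\<exists>Z. is_zero_object C Z"
    and binary_coproducts: "has_finite_coproducts C"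
begin

section \<open>Zero arrows\<close>

lemma zero_object_unique:
  assumes "is_zero_object C Z" "A \<in> Obj C"
  shows "\<exists>!f. f \<in> Hom C Z A" "\<exists>!f. f \<in> Hom C A Z"
  using assms by (simp_all add: is_zero_object_def is_initial_def is_terminal_def)

text \<open>Any two zero objects are linked by a compatible arrow, so the composite does not depend
  on the zero object and the definite description in \<open>zero_arr\<close> is meaningful.\<close>

lemma zero_arr_eqI:
  assumes Z: "is_zero_object C Z" and u: "u \<in> Hom C A Z" and v: "v \<in> Hom C Z B"
  shows "zero_arr C A B = v \<cdot> u"
  unfolding zero_arr_def
proof (rule the_equality)
  show "\<exists>Z. is_zero_object C Z \<and> (\<exists>u'\<in>Hom C A Z. \<exists>v'\<in>Hom C Z B. v \<cdot> u = v' \<cdot> u')"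
    using assms by blast
  fix f assume "\<exists>Z. is_zero_object C Z \<and> (\<exists>u\<in>Hom C A Z. \<exists>v\<in>Hom C Z B. f = v \<cdot> u)"
  then obtain Z' u' v' where Z': "is_zero_object C Z'" and u': "u' \<in> Hom C A Z'"
    and v': "v' \<in> Hom C Z' B" and f: "f = v' \<cdot> u'" by blast
  \<comment> \<open>Terminality of \<open>Z'\<close> and initiality of \<open>Z\<close> make both
    triangles with side \<open>w\<close> commute.\<close>
  obtain w where w: "w \<in> Hom C Z Z'"
    using zero_object_unique(1)[OF Z Hom_Obj(1)[OF v']] by blast
  have "w \<cdot> u = u'"
    using zero_object_unique(2)[OF Z' Hom_Obj(1)[OF u]] Comp_Hom[OF u w] u' by blast
  moreover have "v' \<cdot> w = v"
    using zero_object_unique(1)[OF Z Hom_Obj(2)[OF v]] Comp_Hom[OF w v'] v by blast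
  ultimately show "f = v \<cdot> u" using f Comp_assoc[OF u w v'] by simp
qed

lemma zero_arr_factors:
  assumes "A \<in> Obj C" "B \<in> Obj C"
  shows "\<exists>Z. is_zero_object C Z \<and> (\<exists>u\<in>Hom C A Z. \<exists>v\<in>Hom C Z B. zero_arr C A B = v \<cdot> u)"
proof -
  obtain Z where Z: "is_zero_object C Z" using zero_object by blast
  then obtain u v where "u \<in> Hom C A Z" "v \<in> Hom C Z B"
    using zero_object_unique assms by blast
  then show ?thesis using Z zero_arr_eqI by blast
qed

lemma zero_arr_Hom: "\<lbrakk>A \<in> Obj C; B \<in> Obj C\<rbrakk> \<Longrightarrow> zero_arr C A B \<in> Hom C A B"
  using zero_arr_factors[of A B] Comp_Hom by force

lemma comp_zero_arr:
  assumes f: "f \<in> Hom C X Y" and A: "A \<in> Obj C"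
  shows "f \<cdot> zero_arr C A X = zero_arr C A Y"
proof -
  obtain Z u v where *: "is_zero_object C Z" "u \<in> Hom C A Z" "v \<in> Hom C Z X" "zero_arr C A X = v \<cdot> u"
    using zero_arr_factors[OF A Hom_Obj(1)[OF f]] by blast
  show ?thesis
    using zero_arr_eqI[OF *(1,2) Comp_Hom[OF *(3) f]] *(4) Comp_assoc[OF *(2,3) f] by simp
qed

lemma zero_arr_comp:
  assumes f: "f \<in> Hom C X Y" and A: "A \<in> Obj C"
  shows "zero_arr C Y A \<cdot> f = zero_arr C X A"
proof -
  obtain Z u v where *: "is_zero_object C Z" "u \<in> Hom C Y Z" "v \<in> Hom C Z A" "zero_arr C Y A = v \<cdot> u"
    using zero_arr_factors[OF Hom_Obj(2)[OF f] A] by blast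
  show ?thesis
    using zero_arr_eqI[OF *(1) Comp_Hom[OF f *(2)] *(3)] *(4) Comp_assoc[OF f *(2,3)] by simp
qed

section \<open>Chosen coproducts\<close>

lemma chosen_coproduct:
  assumes "A \<in> Obj C" "B \<in> Obj C"
  shows "is_coproduct C A B (coprod_obj C A B) (inj1 C A B) (inj2 C A B)"
proof -
  have "\<exists>x. case x of (S, i, j) \<Rightarrow> is_coproduct C A B S i j"
    using binary_coproducts assms by (fastforce simp: has_finite_coproducts_def)
  from someI_ex[OF this] show ?thesis
    by (simp add: coprod_obj_def inj1_def inj2_def coprod_choice_def split: prod.splits)
qed

lemma inj_Hom:
  assumes "A \<in> Obj C" "B \<in> Obj C"
  shows "inj1 C A B \<in> Hom C A (coprod_obj C A B)" "inj2 C A B \<in> Hom C B (coprod_obj C A B)"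
    and "coprod_obj C A B \<in> Obj C"
  using chosen_coproduct[OF assms] by (auto simp: is_coproduct_def)

lemma coproduct_eqI:
  assumes "A \<in> Obj C" "B \<in> Obj C" "u \<in> Hom C (coprod_obj C A B) W" "v \<in> Hom C (coprod_obj C A B) W"
    and "u \<cdot> inj1 C A B = v \<cdot> inj1 C A B" "u \<cdot> inj2 C A B = v \<cdot> inj2 C A B"
  shows "u = v"
proof -
  have "v \<cdot> inj1 C A B \<in> Hom C A W" "v \<cdot> inj2 C A B \<in> Hom C B W"
    using assms Comp_Hom inj_Hom by blast+
  then have "\<exists>!w. w \<in> Hom C (coprod_obj C A B) W \<and> w \<cdot> inj1 C A B = v \<cdot> inj1 C A B
      \<and> w \<cdot> inj2 C A B = v \<cdot> inj2 C A B"
    using chosen_coproduct[OF assms(1,2)] unfolding is_coproduct_def by blast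
  then show ?thesis using assms by metis
qed

lemma copairing_props:
  assumes f: "f \<in> Hom C A W" and g: "g \<in> Hom C B W"
  shows "copairing C f g \<in> Hom C (coprod_obj C A B) W"
    and "copairing C f g \<cdot> inj1 C A B = f" and "copairing C f g \<cdot> inj2 C A B = g"
proof -
  have "\<exists>!u. u \<in> Hom C (coprod_obj C A B) W \<and> u \<cdot> inj1 C A B = f \<and> u \<cdot> inj2 C A B = g"
    using chosen_coproduct[OF Hom_Obj(1)[OF f] Hom_Obj(1)[OF g]] f g unfolding is_coproduct_def by blast
  from theI'[OF this] show "copairing C f g \<in> Hom C (coprod_obj C A B) W"
    "copairing C f g \<cdot> inj1 C A B = f" "copairing C f g \<cdot> inj2 C A B = g"
    using f g by (auto simp: copairing_def Hom_def)
qed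

section \<open>Kernels\<close>

lemma ker_is_kernel:
  assumes f: "f \<in> Hom C X Y"
  shows "is_kernel C f (ker C f)"
proof -
  have "parallel C f (zero_arr C (Dom C f) (Cod C f))"
    using f zero_arr_Hom[OF Hom_Obj[OF f]] by (auto simp: parallel_def Hom_def)
  then have "\<exists>k. is_kernel C f k"
    using finite_limits unfolding has_finite_limits_def is_kernel_def by blast
  then show ?thesis unfolding ker_def by (rule someI_ex)
qed

lemma ker_Hom: "f \<in> Hom C X Y \<Longrightarrow> ker C f \<in> Hom C (Ker C f) X"
  using ker_is_kernel[of f X Y] by (auto simp: is_kernel_def is_equalizer_def Ker_def Hom_def)

lemma comp_ker:
  assumes f: "f \<in> Hom C X Y"
  shows "f \<cdot> ker C f = zero_arr C (Ker C f) Y"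
proof -
  have "f \<cdot> ker C f = zero_arr C X Y \<cdot> ker C f"
    using ker_is_kernel[OF f] f by (auto simp: is_kernel_def is_equalizer_def Hom_def)
  then show ?thesis using zero_arr_comp[OF ker_Hom[OF f] Hom_Obj(2)[OF f]] by simp
qed

lemma ker_factor:
  assumes f: "f \<in> Hom C X Y" and x: "x \<in> Hom C W X" and fx: "f \<cdot> x = zero_arr C W Y"
  shows "\<exists>!u. u \<in> Hom C W (Ker C f) \<and> ker C f \<cdot> u = x"
proof -
  have fx': "f \<cdot> x = zero_arr C X Y \<cdot> x"
    using zero_arr_comp[OF x Hom_Obj(2)[OF f]] fx by simp
  have D: "Dom C f = X" "Cod C f = Y" using f by (simp_all add: Hom_def)
  have "\<forall>W. \<forall>x \<in> Hom C W X. f \<cdot> x = zero_arr C X Y \<cdot> x \<longrightarrow>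
      (\<exists>!u. u \<in> Hom C W (Ker C f) \<and> ker C f \<cdot> u = x)"
    using ker_is_kernel[OF f] unfolding is_kernel_def is_equalizer_def Ker_def D by blast
  then show ?thesis using x fx' by blast
qed

lemma ker_cancel:
  assumes f: "f \<in> Hom C X Y" and u: "u \<in> Hom C W (Ker C f)" and v: "v \<in> Hom C W (Ker C f)"
    and eq: "ker C f \<cdot> u = ker C f \<cdot> v"
  shows "u = v"
proof -
  have "f \<cdot> (ker C f \<cdot> v) = zero_arr C W Y"
    using Comp_assoc[OF v ker_Hom[OF f] f] comp_ker[OF f]
      zero_arr_comp[OF v Hom_Obj(2)[OF f]] by simp
  from ker_factor[OF f Comp_Hom[OF v ker_Hom[OF f]] this] show ?thesis using u v eq by blast
qed

text \<open>Since \<open>p = q \<cdot> r\<close>, an element of \<open>A\<close> lies in the kernel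
  of \<open>p\<close> exactly when its image under \<open>r\<close> lies in the kernel of
  \<open>q\<close>. Thus \<open>g\<close> is a pullback of \<open>r\<close>, and regular
  epimorphisms are pullback stable.\<close>

lemma regular_epi_on_kernels:
  assumes r: "regular_epi C r" and rH: "r \<in> Hom C A A'" and q: "q \<in> Hom C A' B"
    and p: "p = q \<cdot> r" and g: "g \<in> Hom C (Ker C p) (Ker C q)" and eq: "ker C q \<cdot> g = r \<cdot> ker C p"
  shows "regular_epi C g"
proof -
  have pH: "p \<in> Hom C A B" using rH q p Comp_Hom by blast
  note kp = ker_Hom[OF pH] and kq = ker_Hom[OF q]
  have "is_pullback C (ker C q) r g (ker C p)"
    unfolding is_pullback_def
  proof (intro conjI allI ballI impI)
    fix W x y assume "x \<in> Hom C W (Dom C (ker C q))" "y \<in> Hom C W (Dom C r)"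
      and xy: "ker C q \<cdot> x = r \<cdot> y"
    then have x: "x \<in> Hom C W (Ker C q)" and y: "y \<in> Hom C W A"
      using kq rH by (auto simp: Hom_def)
    have "p \<cdot> y = q \<cdot> (ker C q \<cdot> x)"
      unfolding p xy using Comp_assoc[OF y rH q] .
    also have "\<dots> = zero_arr C W B"
      using Comp_assoc[OF x kq q] comp_ker[OF q] zero_arr_comp[OF x Hom_Obj(2)[OF q]] by simp
    finally obtain u where u: "u \<in> Hom C W (Ker C p)" "ker C p \<cdot> u = y"
      and uu: "\<And>v. v \<in> Hom C W (Ker C p) \<Longrightarrow> ker C p \<cdot> v = y \<Longrightarrow> v = u"
      using ker_factor[OF pH y] by metis
    have "ker C q \<cdot> (g \<cdot> u) = ker C q \<cdot> x"
      using Comp_assoc[OF u(1) g kq] Comp_assoc[OF u(1) kp rH] eq u(2) xy by simp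
    then have "g \<cdot> u = x" using ker_cancel[OF q Comp_Hom[OF u(1) g] x] by blast
    moreover have "Dom C g = Ker C p" using g by (simp add: Hom_def)
    ultimately show "\<exists>!u. u \<in> Hom C W (Dom C g) \<and> g \<cdot> u = x \<and> ker C p \<cdot> u = y"
      using u uu by (metis (no_types))
  qed (use kp kq rH g eq in \<open>auto simp: Hom_def\<close>)
  from regular_epi_pullback[OF r this] show ?thesis .
qed

section \<open>The monad of actions\<close>

abbreviation plus_proj :: "'a \<Rightarrow> 'a \<Rightarrow> 'b" where
  "plus_proj B X \<equiv> copairing C (Ident C B) (zero_arr C X B)"

text \<open>This is \<open>B + f\<close>, the underlying arrow of
  \<open>FArr (plus_functor C B) f\<close>.\<close>

abbreviation plus_arr :: "'a \<Rightarrow> 'b \<Rightarrow> 'b" where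
  "plus_arr B f \<equiv> copairing C (inj1 C B (Cod C f)) (inj2 C B (Cod C f) \<cdot> f)"

abbreviation flat_obj :: "'a \<Rightarrow> 'a \<Rightarrow> 'a" where
  "flat_obj B X \<equiv> Ker C (plus_proj B X)"

abbreviation flat_incl :: "'a \<Rightarrow> 'a \<Rightarrow> 'b" where
  "flat_incl B X \<equiv> ker C (plus_proj B X)"

abbreviation flat_arr :: "'a \<Rightarrow> 'b \<Rightarrow> 'b" where
  "flat_arr B f \<equiv> TArr (flat_monad C B) f"

lemma plus_proj_props:
  assumes "B \<in> Obj C" "X \<in> Obj C"
  shows "plus_proj B X \<in> Hom C (coprod_obj C B X) B"
    and "plus_proj B X \<cdot> inj1 C B X = Ident C B" "plus_proj B X \<cdot> inj2 C B X = zero_arr C X B"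
  using copairing_props[OF Ident_Hom[OF assms(1)] zero_arr_Hom[OF assms(2,1)]] by auto

lemmas flat_incl_Hom = ker_Hom[OF plus_proj_props(1)]

lemma flat_obj_Obj: "\<lbrakk>B \<in> Obj C; X \<in> Obj C\<rbrakk> \<Longrightarrow> flat_obj B X \<in> Obj C"
  using flat_incl_Hom Hom_Obj by blast

lemma plus_arr_props:
  assumes B: "B \<in> Obj C" and f: "f \<in> Hom C X Y"
  shows "plus_arr B f \<in> Hom C (coprod_obj C B X) (coprod_obj C B Y)"
    and "plus_arr B f \<cdot> inj1 C B X = inj1 C B Y" "plus_arr B f \<cdot> inj2 C B X = inj2 C B Y \<cdot> f"
    and "plus_proj B Y \<cdot> plus_arr B f = plus_proj B X"
proof -
  note O = Hom_Obj[OF f]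
  note i = inj_Hom[OF B O(2)]
  have cod: "Cod C f = Y" using f by (simp add: Hom_def)
  show c: "plus_arr B f \<in> Hom C (coprod_obj C B X) (coprod_obj C B Y)"
    "plus_arr B f \<cdot> inj1 C B X = inj1 C B Y" "plus_arr B f \<cdot> inj2 C B X = inj2 C B Y \<cdot> f"
    unfolding cod using copairing_props[OF i(1) Comp_Hom[OF f i(2)]] by auto
  note p = plus_proj_props[OF B O(2)] and p' = plus_proj_props[OF B O(1)]
  show "plus_proj B Y \<cdot> plus_arr B f = plus_proj B X"
  proof (rule coproduct_eqI[OF B O(1) Comp_Hom[OF c(1) p(1)] p'(1)])
    show "(plus_proj B Y \<cdot> plus_arr B f) \<cdot> inj1 C B X = plus_proj B X \<cdot> inj1 C B X"
      using Comp_assoc[OF inj_Hom(1)[OF B O(1)] c(1) p(1)] c(2) p(2) p'(2) by simp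
    show "(plus_proj B Y \<cdot> plus_arr B f) \<cdot> inj2 C B X = plus_proj B X \<cdot> inj2 C B X"
      using Comp_assoc[OF inj_Hom(2)[OF B O(1)] c(1) p(1)] c(3) p(3) p'(3)
        Comp_assoc[OF f i(2) p(1)] zero_arr_comp[OF f B] by simp
  qed
qed

text \<open>As \<open>p' \<cdot> f = p\<close> annihilates \<open>ker C p\<close>, the arrow
  \<open>f \<cdot> ker C p\<close> factors uniquely through \<open>ker C p'\<close>, which justifies
  the definite description in \<open>Ker_functor\<close>.\<close>

lemma Ker_functor_arr_props:
  assumes p: "p \<in> Hom C A B" and p': "p' \<in> Hom C A' B" and f: "f \<in> Hom C A A'" and eq: "p' \<cdot> f = p"
  shows "FArr (Ker_functor C B) ((A, p, s), f, (A', p', s')) \<in> Hom C (Ker C p) (Ker C p')"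
    and "ker C p' \<cdot> FArr (Ker_functor C B) ((A, p, s), f, (A', p', s')) = f \<cdot> ker C p"
proof -
  note k = ker_Hom[OF p]
  have "p' \<cdot> (f \<cdot> ker C p) = zero_arr C (Ker C p) B"
    using Comp_assoc[OF k f p'] eq comp_ker[OF p] by simp
  from theI'[OF ker_factor[OF p' Comp_Hom[OF k f] this]]
  show "FArr (Ker_functor C B) ((A, p, s), f, (A', p', s')) \<in> Hom C (Ker C p) (Ker C p')"
    "ker C p' \<cdot> FArr (Ker_functor C B) ((A, p, s), f, (A', p', s')) = f \<cdot> ker C p"
    by (simp_all add: Ker_functor_def)
qed

lemma flat_arr_eq:
  "f \<in> Hom C X Y \<Longrightarrow> flat_arr B f = FArr (Ker_functor C B) (plus_obj C B X, plus_arr B f, plus_obj C B Y)"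
  by (simp add: flat_monad_def adjunction_monad_def plus_functor_def Hom_def)

lemma flat_arr_props:
  assumes B: "B \<in> Obj C" and f: "f \<in> Hom C X Y"
  shows "flat_arr B f \<in> Hom C (flat_obj B X) (flat_obj B Y)"
    and "flat_incl B Y \<cdot> flat_arr B f = plus_arr B f \<cdot> flat_incl B X"
  unfolding flat_arr_eq[OF f] plus_obj_def
  using Ker_functor_arr_props[OF plus_proj_props(1)[OF B Hom_Obj(1)[OF f]]
      plus_proj_props(1)[OF B Hom_Obj(2)[OF f]] plus_arr_props(1,4)[OF B f]] by auto

text \<open>Kernel inclusions can be cancelled, so identities between arrows of the form
  \<open>flat_arr B f\<close> reduce to identities between arrows out of coproducts. The functor
  laws below are obtained this way.\<close>

lemma flat_arr_eqI:
  assumes B: "B \<in> Obj C" and f: "f \<in> Hom C X Y" and u: "u \<in> Hom C (flat_obj B X) (flat_obj B Y)"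
    and eq: "flat_incl B Y \<cdot> u = plus_arr B f \<cdot> flat_incl B X"
  shows "flat_arr B f = u"
  using ker_cancel[OF plus_proj_props(1)[OF B Hom_Obj(2)[OF f]] flat_arr_props(1)[OF B f] u]
    flat_arr_props(2)[OF B f] eq by simp

lemma plus_arr_comp:
  assumes B: "B \<in> Obj C" and f: "f \<in> Hom C X Y" and g: "g \<in> Hom C Y Z"
  shows "plus_arr B (g \<cdot> f) = plus_arr B g \<cdot> plus_arr B f"
proof -
  have gf: "g \<cdot> f \<in> Hom C X Z" using Comp_Hom f g .
  note F = plus_arr_props[OF B f] and G = plus_arr_props[OF B g] and GF = plus_arr_props[OF B gf]
  note i = inj_Hom[OF B Hom_Obj(1)[OF f]] and j = inj_Hom[OF B Hom_Obj(2)[OF f]]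
    and l = inj_Hom[OF B Hom_Obj(2)[OF g]]
  show ?thesis
  proof (rule coproduct_eqI[OF B Hom_Obj(1)[OF f] GF(1) Comp_Hom[OF F(1) G(1)]])
    show "plus_arr B (g \<cdot> f) \<cdot> inj1 C B X = (plus_arr B g \<cdot> plus_arr B f) \<cdot> inj1 C B X"
      by (simp only: Comp_assoc[OF i(1) F(1) G(1)] F(2) G(2) GF(2))
    show "plus_arr B (g \<cdot> f) \<cdot> inj2 C B X = (plus_arr B g \<cdot> plus_arr B f) \<cdot> inj2 C B X"
      by (simp only: Comp_assoc[OF i(2) F(1) G(1)] F(3) G(3) GF(3)
          Comp_assoc[OF f j(2) G(1), symmetric] Comp_assoc[OF f g l(2)])
  qed
qed

lemma flat_arr_comp:
  assumes B: "B \<in> Obj C" and f: "f \<in> Hom C X Y" and g: "g \<in> Hom C Y Z"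
  shows "flat_arr B (g \<cdot> f) = flat_arr B g \<cdot> flat_arr B f"
proof -
  note F = flat_arr_props[OF B f] and G = flat_arr_props[OF B g]
  note i = flat_incl_Hom[OF B Hom_Obj(1)[OF f]] and j = flat_incl_Hom[OF B Hom_Obj(2)[OF f]]
    and l = flat_incl_Hom[OF B Hom_Obj(2)[OF g]]
  note F' = plus_arr_props(1)[OF B f] and G' = plus_arr_props(1)[OF B g]
  show ?thesis
  proof (rule flat_arr_eqI[OF B Comp_Hom[OF f g] Comp_Hom[OF F(1) G(1)]])
    show "flat_incl B Z \<cdot> (flat_arr B g \<cdot> flat_arr B f) = plus_arr B (g \<cdot> f) \<cdot> flat_incl B X"
      by (simp only: Comp_assoc[OF F(1) G(1) l, symmetric] G(2) plus_arr_comp[OF B f g]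
          Comp_assoc[OF F(1) j G'] F(2) Comp_assoc[OF i F' G'])
  qed
qed

lemma flat_arr_Ident:
  assumes B: "B \<in> Obj C" and X: "X \<in> Obj C"
  shows "flat_arr B (Ident C X) = Ident C (flat_obj B X)"
proof -
  note I = Ident_Hom[OF X] and i = inj_Hom[OF B X] and k = flat_incl_Hom[OF B X]
  have "plus_arr B (Ident C X) = Ident C (coprod_obj C B X)"
    by (rule coproduct_eqI[OF B X plus_arr_props(1)[OF B I] Ident_Hom[OF i(3)]])
      (simp_all only: plus_arr_props(2,3)[OF B I] Comp_Ident_left[OF i(1)] Comp_Ident_left[OF i(2)]
        Comp_Ident_right[OF i(2)])
  then show ?thesis
    by (intro flat_arr_eqI[OF B I Ident_Hom[OF flat_obj_Obj[OF B X]]])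
      (simp only: Comp_Ident_left[OF k] Comp_Ident_right[OF k])
qed

text \<open>The arrow \<open>B + 0\<close> equals \<open>[1, 0]\<close> followed by the first
  injection, and \<open>[1, 0]\<close> vanishes on its own kernel.\<close>

lemma flat_arr_zero:
  assumes B: "B \<in> Obj C" and X: "X \<in> Obj C" and Y: "Y \<in> Obj C"
  shows "flat_arr B (zero_arr C X Y) = zero_arr C (flat_obj B X) (flat_obj B Y)"
proof -
  note z = zero_arr_Hom[OF X Y] and i = inj_Hom[OF B X] and j = inj_Hom[OF B Y]
  note p = plus_proj_props[OF B X] and k = flat_incl_Hom[OF B X] and l = flat_incl_Hom[OF B Y]
  have "plus_arr B (zero_arr C X Y) = inj1 C B Y \<cdot> plus_proj B X"
    by (rule coproduct_eqI[OF B X plus_arr_props(1)[OF B z] Comp_Hom[OF p(1) j(1)]])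
      (simp_all only: plus_arr_props(2,3)[OF B z] Comp_assoc[OF i(1) p(1) j(1)]
        Comp_assoc[OF i(2) p(1) j(1)] p(2,3) Comp_Ident_right[OF j(1)]
        comp_zero_arr[OF j(1) X] comp_zero_arr[OF j(2) X])
  then show ?thesis
    by (intro flat_arr_eqI[OF B z zero_arr_Hom[OF flat_obj_Obj[OF B X] flat_obj_Obj[OF B Y]]])
      (simp only: Comp_assoc[OF k p(1) j(1)] comp_ker[OF p(1)]
        comp_zero_arr[OF j(1) flat_obj_Obj[OF B X]] comp_zero_arr[OF l flat_obj_Obj[OF B X]])
qed

text \<open>If \<open>e\<close> is a coequalizer of \<open>f\<close> and \<open>g\<close>, then
  \<open>B + e\<close> is a coequalizer of \<open>B + f\<close> and \<open>B + g\<close>. As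
  \<open>B + e\<close> is an arrow over \<open>B\<close>, its restriction to the kernels of the
  projections is again a regular epimorphism.\<close>

lemma flat_arr_regular_epi:
  assumes B: "B \<in> Obj C" and e: "regular_epi C e"
  shows "regular_epi C (flat_arr B e)"
proof -
  obtain f g where fg: "is_coequalizer C f g e" using e by (auto simp: regular_epi_def)
  define R X Y where "R = Dom C f" and "X = Dom C e" and "Y = Cod C e"
  have eH: "e \<in> Hom C X Y" and fH: "f \<in> Hom C R X" and gH: "g \<in> Hom C R X" and eq: "e \<cdot> f = e \<cdot> g"
    using fg by (auto simp: is_coequalizer_def parallel_def Hom_def R_def X_def Y_def)
  note E = plus_arr_props[OF B eH] and F = plus_arr_props[OF B fH] and G = plus_arr_props[OF B gH]
  note X = Hom_Obj(1)[OF eH] and Y = Hom_Obj(2)[OF eH] and R = Hom_Obj(1)[OF fH]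
  note i = inj_Hom[OF B R] and j = inj_Hom[OF B X] and l = inj_Hom[OF B Y]
  have "is_coequalizer C (plus_arr B f) (plus_arr B g) (plus_arr B e)"
    unfolding is_coequalizer_def
  proof (intro conjI allI ballI impI)
    show "parallel C (plus_arr B f) (plus_arr B g)" using F(1) G(1) by (simp add: parallel_def Hom_def)
    show "plus_arr B e \<in> Arr C" "Dom C (plus_arr B e) = Cod C (plus_arr B f)"
      using E(1) F(1) by (simp_all add: Hom_def)
    show "plus_arr B e \<cdot> plus_arr B f = plus_arr B e \<cdot> plus_arr B g"
      using plus_arr_comp[OF B fH eH] plus_arr_comp[OF B gH eH] eq by metis
    fix W x assume "x \<in> Hom C (Cod C (plus_arr B f)) W" and xeq: "x \<cdot> plus_arr B f = x \<cdot> plus_arr B g"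
    then have x: "x \<in> Hom C (coprod_obj C B X) W" using F(1) by (simp add: Hom_def)
    \<comment> \<open>Only the second summand is affected by \<open>f\<close> and \<open>g\<close>.
      There \<open>x\<close> takes equal values on them, so it descends along \<open>e\<close> to
      some \<open>z\<close>; on the summand \<open>B\<close> nothing changes, and the factorization
      is \<open>[x \<cdot> inj1 C B X, z]\<close>.\<close>
    have "(x \<cdot> inj2 C B X) \<cdot> f = (x \<cdot> plus_arr B f) \<cdot> inj2 C B R"
      by (simp only: Comp_assoc[OF fH j(2) x] F(3)[symmetric] Comp_assoc[OF i(2) F(1) x])
    also have "\<dots> = (x \<cdot> inj2 C B X) \<cdot> g"
      by (simp only: xeq Comp_assoc[OF gH j(2) x] G(3)[symmetric] Comp_assoc[OF i(2) G(1) x])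
    moreover have "x \<cdot> inj2 C B X \<in> Hom C (Cod C f) W"
      using Comp_Hom[OF j(2) x] fH by (simp add: Hom_def)
    ultimately obtain z where z: "z \<in> Hom C Y W" "z \<cdot> e = x \<cdot> inj2 C B X"
      using fg unfolding is_coequalizer_def Y_def by metis
    note u = copairing_props[OF Comp_Hom[OF j(1) x] z(1)]
    have dom: "Cod C (plus_arr B e) = coprod_obj C B Y" using E(1) by (simp add: Hom_def)
    show "\<exists>!u. u \<in> Hom C (Cod C (plus_arr B e)) W \<and> u \<cdot> plus_arr B e = x"
      unfolding dom
    proof (rule ex1I[of _ "copairing C (x \<cdot> inj1 C B X) z"], intro conjI)
      show "copairing C (x \<cdot> inj1 C B X) z \<in> Hom C (coprod_obj C B Y) W" by (rule u(1))
      show "copairing C (x \<cdot> inj1 C B X) z \<cdot> plus_arr B e = x"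
        by (rule coproduct_eqI[OF B X Comp_Hom[OF E(1) u(1)] x])
          (simp_all only: Comp_assoc[OF j(1) E(1) u(1)] Comp_assoc[OF j(2) E(1) u(1)] E(2,3) u(2)
            Comp_assoc[OF eH l(2) u(1), symmetric] u(3) z(2))
      fix v assume v: "v \<in> Hom C (coprod_obj C B Y) W \<and> v \<cdot> plus_arr B e = x"
      then have vH: "v \<in> Hom C (coprod_obj C B Y) W" by blast
      have v1: "v \<cdot> inj1 C B Y = x \<cdot> inj1 C B X"
        using v Comp_assoc[OF j(1) E(1) vH] E(2) by metis
      have "(v \<cdot> inj2 C B Y) \<cdot> e = z \<cdot> e"
        using v z(2) Comp_assoc[OF j(2) E(1) vH] E(3) Comp_assoc[OF eH l(2) vH] by metis
      then have v2: "v \<cdot> inj2 C B Y = z"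
        using coequalizer_epi[OF fg, of "v \<cdot> inj2 C B Y" W z] Comp_Hom[OF l(2) vH] z(1) by (simp add: Y_def)
      show "v = copairing C (x \<cdot> inj1 C B X) z"
        by (rule coproduct_eqI[OF B Y vH u(1)]) (simp_all only: v1 v2 u(2,3))
    qed
  qed
  then have "regular_epi C (plus_arr B e)" by (auto simp: regular_epi_def)
  then show ?thesis
    using regular_epi_on_kernels[OF _ E(1) plus_proj_props(1)[OF B Y] E(4)[symmetric]]
      flat_arr_props[OF B eH] by blast
qed

section \<open>Unit, multiplication and their naturality\<close>

lemma flat_unit_props:
  assumes B: "B \<in> Obj C" and X: "X \<in> Obj C"
  shows "unit_mnd (flat_monad C B) X \<in> Hom C X (flat_obj B X)"
    and "flat_incl B X \<cdot> unit_mnd (flat_monad C B) X = inj2 C B X"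
proof -
  note p = plus_proj_props[OF B X]
  from theI'[OF ker_factor[OF p(1) inj_Hom(2)[OF B X] p(3)]]
  show "unit_mnd (flat_monad C B) X \<in> Hom C X (flat_obj B X)"
    "flat_incl B X \<cdot> unit_mnd (flat_monad C B) X = inj2 C B X"
    by (simp_all add: flat_monad_def adjunction_monad_def plus_Ker_unit_def Let_def)
qed

text \<open>The counit at the point \<open>B + X\<close> is the copairing of the first injection
  with the kernel inclusion. It lies over \<open>B\<close> because \<open>[1, 0]\<close> kills that
  inclusion, and the multiplication is what it induces on kernels.\<close>

lemma flat_mult_props:
  assumes B: "B \<in> Obj C" and X: "X \<in> Obj C"
  shows "mult_mnd (flat_monad C B) X \<in> Hom C (flat_obj B (flat_obj B X)) (flat_obj B X)"
    and "flat_incl B X \<cdot> mult_mnd (flat_monad C B) X =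
      copairing C (inj1 C B X) (flat_incl B X) \<cdot> flat_incl B (flat_obj B X)"
proof -
  note F = flat_obj_Obj[OF B X] and k = flat_incl_Hom[OF B X] and i = inj_Hom[OF B X]
  note p = plus_proj_props[OF B X] and p' = plus_proj_props[OF B F] and j = inj_Hom[OF B F]
  note c = copairing_props[OF i(1) k]
  have "plus_proj B X \<cdot> copairing C (inj1 C B X) (flat_incl B X) = plus_proj B (flat_obj B X)"
    by (rule coproduct_eqI[OF B F Comp_Hom[OF c(1) p(1)] p'(1)])
      (simp_all only: Comp_assoc[OF j(1) c(1) p(1)] Comp_assoc[OF j(2) c(1) p(1)] c(2,3) p(2) p'(2,3)
        comp_ker[OF p(1)])
  from Ker_functor_arr_props[OF p'(1) p(1) c(1) this]
  show "mult_mnd (flat_monad C B) X \<in> Hom C (flat_obj B (flat_obj B X)) (flat_obj B X)"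
    "flat_incl B X \<cdot> mult_mnd (flat_monad C B) X =
      copairing C (inj1 C B X) (flat_incl B X) \<cdot> flat_incl B (flat_obj B X)"
    by (simp_all add: flat_monad_def adjunction_monad_def plus_functor_def plus_obj_def
        plus_Ker_counit_def)
qed

lemma flat_unit_natural:
  assumes B: "B \<in> Obj C" and f: "f \<in> Hom C X Y"
  shows "flat_arr B f \<cdot> unit_mnd (flat_monad C B) X = unit_mnd (flat_monad C B) Y \<cdot> f"
proof -
  note X = Hom_Obj(1)[OF f] and Y = Hom_Obj(2)[OF f]
  note u = flat_unit_props[OF B X] and v = flat_unit_props[OF B Y] and F = flat_arr_props[OF B f]
  note k = flat_incl_Hom[OF B X] and l = flat_incl_Hom[OF B Y] and P = plus_arr_props[OF B f]
  show ?thesis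
    by (rule ker_cancel[OF plus_proj_props(1)[OF B Y] Comp_Hom[OF u(1) F(1)] Comp_Hom[OF f v(1)]])
      (simp only: Comp_assoc[OF u(1) F(1) l, symmetric] F(2) Comp_assoc[OF u(1) k P(1)] u(2) P(3)
        Comp_assoc[OF f v(1) l, symmetric] v(2))
qed

lemma flat_mult_natural:
  assumes B: "B \<in> Obj C" and f: "f \<in> Hom C X Y"
  shows "flat_arr B f \<cdot> mult_mnd (flat_monad C B) X =
    mult_mnd (flat_monad C B) Y \<cdot> flat_arr B (flat_arr B f)"
proof -
  note X = Hom_Obj(1)[OF f] and Y = Hom_Obj(2)[OF f]
  note FX = flat_obj_Obj[OF B X] and FY = flat_obj_Obj[OF B Y]
  note u = flat_mult_props[OF B X] and v = flat_mult_props[OF B Y] and F = flat_arr_props[OF B f]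
  note FF = flat_arr_props[OF B F(1)]
  note k = flat_incl_Hom[OF B X] and l = flat_incl_Hom[OF B Y] and P = plus_arr_props[OF B f]
    and Q = plus_arr_props[OF B F(1)]
  note kk = flat_incl_Hom[OF B FX] and ll = flat_incl_Hom[OF B FY]
  note i = inj_Hom[OF B X] and j = inj_Hom[OF B Y] and ii = inj_Hom[OF B FX] and jj = inj_Hom[OF B FY]
  note c = copairing_props[OF i(1) k] and d = copairing_props[OF j(1) l]
  \<comment> \<open>Naturality of the counit, checked on the two summands; restricting it to kernels
    gives naturality of the multiplication.\<close>
  have "plus_arr B f \<cdot> copairing C (inj1 C B X) (flat_incl B X)
      = copairing C (inj1 C B Y) (flat_incl B Y) \<cdot> plus_arr B (flat_arr B f)"
    by (rule coproduct_eqI[OF B FX Comp_Hom[OF c(1) P(1)] Comp_Hom[OF Q(1) d(1)]])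
      (simp_all only: Comp_assoc[OF ii(1) c(1) P(1)] Comp_assoc[OF ii(2) c(1) P(1)] c(2,3) P(2)
        Comp_assoc[OF ii(1) Q(1) d(1)] Comp_assoc[OF ii(2) Q(1) d(1)] Q(2,3) d(2) F(2)[symmetric]
        Comp_assoc[OF F(1) jj(2) d(1), symmetric] d(3))
  then show ?thesis
    by (intro ker_cancel[OF plus_proj_props(1)[OF B Y] Comp_Hom[OF u(1) F(1)] Comp_Hom[OF FF(1) v(1)]])
      (simp only: Comp_assoc[OF u(1) F(1) l, symmetric] F(2) Comp_assoc[OF u(1) k P(1)] u(2)
        Comp_assoc[OF FF(1) v(1) l, symmetric] v(2) Comp_assoc[OF FF(1) ll d(1)] FF(2)
        Comp_assoc[OF kk c(1) P(1), symmetric] Comp_assoc[OF kk Q(1) d(1)])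
qed

text \<open>After composition with \<open>m\<close>, naturality of unit and multiplication turns
  each law for \<open>\<xi>'\<close> into the corresponding law for \<open>\<xi>\<close>; then
  \<open>m\<close> is cancelled.\<close>

lemma is_action_restrict:
  assumes B: "B \<in> Obj C" and act: "is_action C B G \<xi>" and m: "monic C m" "m \<in> Hom C M G"
    and \<xi>': "\<xi>' \<in> Hom C (flat_obj B M) M" and eq: "m \<cdot> \<xi>' = \<xi> \<cdot> flat_arr B m"
  shows "is_action C B M \<xi>'"
proof -
  let ?\<eta> = "unit_mnd (flat_monad C B)" and ?\<mu> = "mult_mnd (flat_monad C B)"
  note G = Hom_Obj(2)[OF m(2)] and M = Hom_Obj(1)[OF m(2)]
  have T: "TObj (flat_monad C B) X = flat_obj B X" for X
    by (simp add: flat_monad_def adjunction_monad_def Ker_functor_def plus_functor_def plus_obj_def)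
  have \<xi>: "\<xi> \<in> Hom C (flat_obj B G) G" "\<xi> \<cdot> ?\<eta> G = Ident C G" "\<xi> \<cdot> ?\<mu> G = \<xi> \<cdot> flat_arr B \<xi>"
    using act by (auto simp: is_action_def is_algebra_def T)
  note u = flat_unit_props(1)[OF B M] and u' = flat_unit_props(1)[OF B G]
  note v = flat_mult_props(1)[OF B M] and v' = flat_mult_props(1)[OF B G]
  note Fm = flat_arr_props(1)[OF B m(2)] and F\<xi> = flat_arr_props(1)[OF B \<xi>(1)]
    and F\<xi>' = flat_arr_props(1)[OF B \<xi>']
  note FFm = flat_arr_props(1)[OF B Fm]
  have D: "Dom C m = M" using m(2) by (simp add: Hom_def)
  have cancel: "a = b" if "a \<in> Hom C W M" "b \<in> Hom C W M" "m \<cdot> a = m \<cdot> b" for a b W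
    by (rule monicD[OF m(1), unfolded D, OF that])
  have "m \<cdot> (\<xi>' \<cdot> ?\<eta> M) = m \<cdot> Ident C M"
    by (simp only: Comp_assoc[OF u \<xi>' m(2), symmetric] eq Comp_assoc[OF u Fm \<xi>(1)]
        flat_unit_natural[OF B m(2)] Comp_assoc[OF m(2) u' \<xi>(1), symmetric] \<xi>(2)
        Comp_Ident_left[OF m(2)] Comp_Ident_right[OF m(2)])
  then have "\<xi>' \<cdot> ?\<eta> M = Ident C M"
    by (rule cancel[OF Comp_Hom[OF u \<xi>'] Ident_Hom[OF M]])
  moreover have "m \<cdot> (\<xi>' \<cdot> ?\<mu> M) = m \<cdot> (\<xi>' \<cdot> flat_arr B \<xi>')"
  proof -
    have "m \<cdot> (\<xi>' \<cdot> ?\<mu> M) = (\<xi> \<cdot> flat_arr B \<xi>) \<cdot> flat_arr B (flat_arr B m)"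
      by (simp only: Comp_assoc[OF v \<xi>' m(2), symmetric] eq Comp_assoc[OF v Fm \<xi>(1)]
          flat_mult_natural[OF B m(2)] Comp_assoc[OF FFm v' \<xi>(1), symmetric] \<xi>(3))
    also have "\<dots> = \<xi> \<cdot> flat_arr B (m \<cdot> \<xi>')"
      by (simp only: eq flat_arr_comp[OF B Fm \<xi>(1)] Comp_assoc[OF FFm F\<xi> \<xi>(1)])
    also have "\<dots> = m \<cdot> (\<xi>' \<cdot> flat_arr B \<xi>')"
      by (simp only: flat_arr_comp[OF B \<xi>' m(2)] Comp_assoc[OF F\<xi>' Fm \<xi>(1), symmetric]
          eq[symmetric] Comp_assoc[OF F\<xi>' \<xi>' m(2)])
    finally show ?thesis .
  qed
  then have "\<xi>' \<cdot> ?\<mu> M = \<xi>' \<cdot> flat_arr B \<xi>'"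
    by (rule cancel[OF Comp_Hom[OF v \<xi>'] Comp_Hom[OF F\<xi>' \<xi>']])
  ultimately show ?thesis using \<xi>' by (simp add: is_action_def is_algebra_def T)
qed

text \<open>Reduces the notion to a bare factorization: the action laws restrict along
  \<open>m\<close>, and uniqueness follows from \<open>m\<close> being monic.\<close>

lemma characteristicI:
  assumes m: "monic C m" "m \<in> Hom C M G"
    and "\<And>B \<xi>. B \<in> Obj C \<Longrightarrow> is_action C B G \<xi> \<Longrightarrow>
      \<exists>\<xi>' \<in> Hom C (flat_obj B M) M. m \<cdot> \<xi>' = \<xi> \<cdot> flat_arr B m"
  shows "characteristic C G m"
  unfolding characteristic_def
proof (intro conjI ballI allI impI)
  have D: "Dom C m = M" using m by (simp add: Hom_def)
  fix B \<xi> assume B: "B \<in> Obj C" and act: "is_action C B G \<xi>"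
  obtain \<xi>' where \<xi>': "\<xi>' \<in> Hom C (flat_obj B M) M" "m \<cdot> \<xi>' = \<xi> \<cdot> flat_arr B m"
    using assms(3)[OF B act] by blast
  have hom: "\<zeta> \<in> Hom C (flat_obj B M) (Dom C m)" if "is_action C B M \<zeta>" for \<zeta>
    using that by (simp add: D is_action_def is_algebra_def flat_monad_def adjunction_monad_def
        Ker_functor_def plus_functor_def plus_obj_def)
  show "\<exists>!\<xi>'. is_action C B (Dom C m) \<xi>' \<and> m \<cdot> \<xi>' = \<xi> \<cdot> flat_arr B m"
    unfolding D
  proof (rule ex1I[of _ \<xi>'], intro conjI)
    show act': "is_action C B M \<xi>'" by (rule is_action_restrict[OF B act m \<xi>'])
    show "m \<cdot> \<xi>' = \<xi> \<cdot> flat_arr B m" by fact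
    fix \<zeta> assume \<zeta>: "is_action C B M \<zeta> \<and> m \<cdot> \<zeta> = \<xi> \<cdot> flat_arr B m"
    then show "\<zeta> = \<xi>'" using monicD[OF m(1) hom hom[OF act']] \<xi>'(2) by metis
  qed
qed (use m in \<open>auto simp: Hom_def\<close>)

section \<open>Jointly strongly epic pairs of points\<close>

lemma Pt_factors_throughD:
  assumes "factors_through (Pt C B) ((X, q, i), f, Y) ((A, p, s), n, Y')"
  shows "\<exists>u. u \<in> Hom C X A \<and> p \<cdot> u = q \<and> f = n \<cdot> u"
proof -
  obtain w where w: "w \<in> Hom (Pt C B) (X, q, i) (A, p, s)"
      and fw: "((X, q, i), f, Y) = ((A, p, s), n, Y') \<cdot>\<^bsub>Pt C B\<^esub> w"
    using assms unfolding factors_through_def by (auto simp: Pt_def)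
  obtain X' u A' where w': "w = (X', u, A')" by (metis prod_cases3)
  have "u \<in> Hom C X A \<and> p \<cdot> u = q" using w by (auto simp: w' Pt_def Hom_def)
  moreover have "f = n \<cdot> u" using fw by (simp add: w' Pt_def)
  ultimately show ?thesis by blast
qed

text \<open>A left adjoint preserves coproducts, so \<open>B + (H + K)\<close> is the coproduct of
  the points \<open>B + H\<close> and \<open>B + K\<close>. Factorizations of both injections
  through a monomorphism therefore assemble into a right inverse of it, and a monomorphism with a
  right inverse is invertible.\<close>

lemma plus_functor_jointly_strongly_epic:
  assumes B: "B \<in> Obj C" and H: "H \<in> Obj C" and K: "K \<in> Obj C"
  shows "jointly_strongly_epic (Pt C B) (FArr (plus_functor C B) (inj1 C H K))
    (FArr (plus_functor C B) (inj2 C H K))"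
proof -
  define S where "S = coprod_obj C H K"
  have i: "inj1 C H K \<in> Hom C H S" and j: "inj2 C H K \<in> Hom C K S" and S: "S \<in> Obj C"
    using inj_Hom[OF H K] by (auto simp: S_def)
  have fi: "FArr (plus_functor C B) (inj1 C H K)
      = (plus_obj C B H, plus_arr B (inj1 C H K), plus_obj C B S)"
    and fj: "FArr (plus_functor C B) (inj2 C H K)
      = (plus_obj C B K, plus_arr B (inj2 C H K), plus_obj C B S)"
    using i j by (auto simp: plus_functor_def Hom_def)
  note Pi = plus_arr_props[OF B i] and Pj = plus_arr_props[OF B j]
  note pH = plus_proj_props[OF B H] and pK = plus_proj_props[OF B K] and pS = plus_proj_props[OF B S]
  note iH = inj_Hom[OF B H] and iK = inj_Hom[OF B K] and iS = inj_Hom[OF B S]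
  have arr: "(plus_obj C B H, plus_arr B (inj1 C H K), plus_obj C B S) \<in> Arr (Pt C B)"
    "(plus_obj C B K, plus_arr B (inj2 C H K), plus_obj C B S) \<in> Arr (Pt C B)"
    using Pi Pj pH pK pS iH iK iS by (auto simp: Pt_def plus_obj_def)
  show ?thesis
    unfolding jointly_strongly_epic_def fi fj
  proof (intro conjI allI impI)
    fix m assume asm: "monic (Pt C B) m \<and>
      Cod (Pt C B) m = Cod (Pt C B) (plus_obj C B H, plus_arr B (inj1 C H K), plus_obj C B S) \<and>
      factors_through (Pt C B) (plus_obj C B H, plus_arr B (inj1 C H K), plus_obj C B S) m \<and>
      factors_through (Pt C B) (plus_obj C B K, plus_arr B (inj2 C H K), plus_obj C B S) m"
    then have mon: "monic (Pt C B) m" by blast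
    then have mA: "m \<in> Arr (Pt C B)" by (simp add: monic_def)
    obtain A p s n Y where m0: "m = ((A, p, s), n, Y)" by (metis prod_cases3)
    have m: "m = ((A, p, s), n, plus_obj C B S)"
      using asm m0 by (simp add: Pt_def)
    have p: "p \<in> Hom C A B" and s: "s \<in> Hom C B A" and ps: "p \<cdot> s = Ident C B"
      and n: "n \<in> Hom C A (coprod_obj C B S)" and pn: "plus_proj B S \<cdot> n = p" and ns: "n \<cdot> s = inj1 C B S"
      using mA unfolding m by (auto simp: Pt_def plus_obj_def)
    have "\<exists>u. u \<in> Hom C (coprod_obj C B H) A \<and> p \<cdot> u = plus_proj B H \<and> plus_arr B (inj1 C H K) = n \<cdot> u"
      using asm Pt_factors_throughD unfolding m plus_obj_def by blast
    then obtain u where u: "u \<in> Hom C (coprod_obj C B H) A" "p \<cdot> u = plus_proj B H"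
      "plus_arr B (inj1 C H K) = n \<cdot> u" by blast
    have "\<exists>v. v \<in> Hom C (coprod_obj C B K) A \<and> p \<cdot> v = plus_proj B K \<and> plus_arr B (inj2 C H K) = n \<cdot> v"
      using asm Pt_factors_throughD unfolding m plus_obj_def by blast
    then obtain v where v: "v \<in> Hom C (coprod_obj C B K) A" "p \<cdot> v = plus_proj B K"
      "plus_arr B (inj2 C H K) = n \<cdot> v" by blast
    note w = copairing_props[OF Comp_Hom[OF iH(2) u(1)] Comp_Hom[OF iK(2) v(1)], folded S_def]
    \<comment> \<open>The right inverse is glued from three pieces: \<open>s\<close> on
      \<open>B\<close>, and the restrictions of \<open>u\<close> and \<open>v\<close> on
      \<open>H\<close> and \<open>K\<close>.\<close>
    define t where "t = copairing C s (copairing C (u \<cdot> inj2 C B H) (v \<cdot> inj2 C B K))"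
    have t: "t \<in> Hom C (coprod_obj C B S) A" and t1: "t \<cdot> inj1 C B S = s"
      and t2: "t \<cdot> inj2 C B S = copairing C (u \<cdot> inj2 C B H) (v \<cdot> inj2 C B K)"
      using copairing_props[OF s w(1)] by (simp_all add: t_def)
    have nw: "n \<cdot> copairing C (u \<cdot> inj2 C B H) (v \<cdot> inj2 C B K) = inj2 C B S"
      by (rule coproduct_eqI[OF H K, folded S_def, OF Comp_Hom[OF w(1) n] iS(2)])
        (simp_all only: Comp_assoc[OF i w(1) n] Comp_assoc[OF j w(1) n] w(2,3)
          Comp_assoc[OF iH(2) u(1) n, symmetric] Comp_assoc[OF iK(2) v(1) n, symmetric]
          u(3)[symmetric] v(3)[symmetric] Pi(3) Pj(3))
    have nt: "n \<cdot> t = Ident C (coprod_obj C B S)"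
      by (rule coproduct_eqI[OF B S Comp_Hom[OF t n] Ident_Hom[OF iS(3)]])
        (simp_all only: Comp_assoc[OF iS(1) t n] Comp_assoc[OF iS(2) t n] t1 t2 ns nw
          Comp_Ident_left[OF iS(1)] Comp_Ident_left[OF iS(2)])
    have pt: "p \<cdot> t = plus_proj B S"
      by (simp only: pn[symmetric] Comp_assoc[OF t n pS(1)] nt Comp_Ident_right[OF pS(1)])
    \<comment> \<open>The monomorphism \<open>m\<close> cancels arrows of points only, so
      \<open>t \<cdot> n\<close> must be seen to preserve \<open>p\<close> and \<open>s\<close>
      before it can be compared with the identity.\<close>
    have tn: "t \<cdot> n \<in> Hom C A A" "p \<cdot> (t \<cdot> n) = p" "(t \<cdot> n) \<cdot> s = s" "n \<cdot> (t \<cdot> n) = n \<cdot> Ident C A"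
      using Comp_Hom[OF n t] Comp_assoc[OF n t p] pt pn Comp_assoc[OF s n t] ns t1
        Comp_assoc[OF n t n] nt Comp_Ident_left[OF n] Comp_Ident_right[OF n] by auto
    note A = Ident_Hom[OF Hom_Obj(1)[OF p]] Comp_Ident_right[OF p] Comp_Ident_left[OF s]
    define P where "P = (A, p, s)"
    have "(P, t \<cdot> n, P) = (P, Ident C A, P)"
    proof (rule mon[unfolded monic_def m, THEN conjunct2, rule_format])
      show "(P, t \<cdot> n, P) \<in> Hom (Pt C B) P (Dom (Pt C B) ((A, p, s), n, plus_obj C B S))"
        "(P, Ident C A, P) \<in> Hom (Pt C B) P (Dom (Pt C B) ((A, p, s), n, plus_obj C B S))"
        using p s ps tn A by (auto simp: Pt_def Hom_def P_def)
      show "((A, p, s), n, plus_obj C B S) \<cdot>\<^bsub>Pt C B\<^esub> (P, t \<cdot> n, P)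
          = ((A, p, s), n, plus_obj C B S) \<cdot>\<^bsub>Pt C B\<^esub> (P, Ident C A, P)"
        using tn(4) by (simp add: Pt_def)
    qed
    then have tn_id: "t \<cdot> n = Ident C A" by simp
    have "(plus_obj C B S, t, (A, p, s)) \<in> Hom (Pt C B) (Cod (Pt C B) m) (Dom (Pt C B) m)"
      using t p s ps pS iS pt t1 unfolding m by (auto simp: Pt_def Hom_def plus_obj_def)
    moreover have "(plus_obj C B S, t, (A, p, s)) \<cdot>\<^bsub>Pt C B\<^esub> m = Ident (Pt C B) (Dom (Pt C B) m)"
      "m \<cdot>\<^bsub>Pt C B\<^esub> (plus_obj C B S, t, (A, p, s)) = Ident (Pt C B) (Cod (Pt C B) m)"
      unfolding m by (simp_all add: Pt_def tn_id nt) (simp_all add: plus_obj_def)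
    ultimately show "isomorphism (Pt C B) m" using mA unfolding isomorphism_def by blast
  qed (use arr in \<open>auto simp: Pt_def\<close>)
qed

text \<open>The two components are jointly strongly epic by the preservation hypothesis. Both factor
  through the image \<open>m\<close> of the copairing, so \<open>m\<close> is invertible and the
  copairing agrees with its regular epic part up to isomorphism.\<close>

lemma flat_copairing_regular_epi:
  assumes pres: "preserves_jointly_strongly_epic (Pt C B) C (Ker_functor C B)"
    and B: "B \<in> Obj C" and H: "H \<in> Obj C" and K: "K \<in> Obj C"
  shows "regular_epi C (copairing C (flat_arr B (inj1 C H K)) (flat_arr B (inj2 C H K)))"
    (is "regular_epi C ?r")
proof -
  note i = inj_Hom[OF H K]
  note I = flat_arr_props(1)[OF B i(1)] and J = flat_arr_props(1)[OF B i(2)]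
  note r = copairing_props[OF I J] and e = inj_Hom[OF Hom_Obj(1)[OF I] Hom_Obj(1)[OF J]]
  have jse: "jointly_strongly_epic C (flat_arr B (inj1 C H K)) (flat_arr B (inj2 C H K))"
    \<comment> \<open>\<open>flat_arr B\<close> is by definition \<open>Ker_functor\<close> after
      \<open>plus_functor\<close>, so the hypothesis applies directly to the pair of points
      above.\<close>
    using pres[unfolded preserves_jointly_strongly_epic_def, rule_format,
        OF plus_functor_jointly_strongly_epic[OF B H K]]
    by (simp add: flat_monad_def adjunction_monad_def)
  obtain m q where m: "monic C m" and q: "regular_epi C q" "Cod C q = Dom C m" and rm: "?r = m \<cdot> q"
    using regular_image_exists[of ?r] r(1) by (auto simp: is_regular_image_def Hom_def)
  have mA: "m \<in> Arr C" and qA: "q \<in> Arr C" using m q regular_epi_Arr by (auto simp: monic_def)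
  have qH: "q \<in> Hom C (coprod_obj C (flat_obj B H) (flat_obj B K)) (Dom C m)"
    and mH: "m \<in> Hom C (Dom C m) (flat_obj B (coprod_obj C H K))"
    using r(1) mA qA q(2) unfolding rm by (auto simp: comp_simps)
  have "flat_arr B (inj1 C H K) = m \<cdot> (q \<cdot> inj1 C (flat_obj B H) (flat_obj B K))"
    "flat_arr B (inj2 C H K) = m \<cdot> (q \<cdot> inj2 C (flat_obj B H) (flat_obj B K))"
    using r(2,3) unfolding rm by (simp_all only: Comp_assoc[OF e(1) qH mH] Comp_assoc[OF e(2) qH mH])
  then have "factors_through C (flat_arr B (inj1 C H K)) m" "factors_through C (flat_arr B (inj2 C H K)) m"
    using factors_throughI[OF Comp_Hom[OF e(1) qH] mH] factors_throughI[OF Comp_Hom[OF e(2) qH] mH]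
    by auto
  moreover have "Cod C m = Cod C (flat_arr B (inj1 C H K))" using mH I by (simp add: Hom_def)
  ultimately have "isomorphism C m" using jse m unfolding jointly_strongly_epic_def by blast
  then show ?thesis
    unfolding rm using isomorphism_comp_regular_epi[OF q(1)] q(2) by simp
qed

section \<open>Higgins commutators of characteristic subobjects\<close>

lemma sum_to_prod_props:
  assumes H: "H \<in> Obj C" and K: "K \<in> Obj C"
  shows "sum_to_prod C H K \<in> Hom C (coprod_obj C H K) (prod_obj C H K)"
    and "proj1 C H K \<cdot> sum_to_prod C H K = copairing C (Ident C H) (zero_arr C K H)"
    and "proj2 C H K \<cdot> sum_to_prod C H K = copairing C (zero_arr C H K) (Ident C K)"
  unfolding sum_to_prod_def
  using pairing_props[OF copairing_props(1)[OF Ident_Hom[OF H] zero_arr_Hom[OF K H]]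
      copairing_props(1)[OF zero_arr_Hom[OF H K] Ident_Hom[OF K]]] by auto

text \<open>A comparison of two-by-two matrices: the diagonal entries are images of identities, the
  others images of zero arrows, and \<open>flat_arr B\<close> preserves both. It exhibits the
  canonical arrow for \<open>flat_obj B H\<close> and \<open>flat_obj B K\<close> as passing through
  \<open>flat_obj B (coprod_obj C H K)\<close>.\<close>

lemma flat_pairing_copairing:
  assumes B: "B \<in> Obj C" and H: "H \<in> Obj C" and K: "K \<in> Obj C"
  shows "pairing C (flat_arr B (copairing C (Ident C H) (zero_arr C K H)))
        (flat_arr B (copairing C (zero_arr C H K) (Ident C K)))
      \<cdot> copairing C (flat_arr B (inj1 C H K)) (flat_arr B (inj2 C H K))
    = sum_to_prod C (flat_obj B H) (flat_obj B K)"
    (is "pairing C (flat_arr B ?p) (flat_arr B ?q) \<cdot> ?r = _")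
proof -
  note i = inj_Hom[OF H K]
  note I = flat_arr_props(1)[OF B i(1)] and J = flat_arr_props(1)[OF B i(2)]
  note r = copairing_props[OF I J] and e = inj_Hom[OF Hom_Obj(1)[OF I] Hom_Obj(1)[OF J]]
  note HB = flat_obj_Obj[OF B H] and KB = flat_obj_Obj[OF B K]
  note p = copairing_props[OF Ident_Hom[OF H] zero_arr_Hom[OF K H]]
    and q = copairing_props[OF zero_arr_Hom[OF H K] Ident_Hom[OF K]]
  note P = flat_arr_props(1)[OF B p(1)] and Q = flat_arr_props(1)[OF B q(1)]
  note t = pairing_props[OF P Q] and \<Sigma> = sum_to_prod_props[OF HB KB]
  note p' = copairing_props[OF Ident_Hom[OF HB] zero_arr_Hom[OF KB HB]]
    and q' = copairing_props[OF zero_arr_Hom[OF HB KB] Ident_Hom[OF KB]]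
  have "flat_arr B ?p \<cdot> ?r = copairing C (Ident C (flat_obj B H)) (zero_arr C (flat_obj B K) (flat_obj B H))"
    by (rule coproduct_eqI[OF HB KB Comp_Hom[OF r(1) P] p'(1)])
      (simp_all only: Comp_assoc[OF e(1) r(1) P] Comp_assoc[OF e(2) r(1) P] r(2,3) p'(2,3)
        flat_arr_comp[OF B i(1) p(1), symmetric] flat_arr_comp[OF B i(2) p(1), symmetric] p(2,3)
        flat_arr_Ident[OF B H] flat_arr_zero[OF B K H])
  moreover have "flat_arr B ?q \<cdot> ?r = copairing C (zero_arr C (flat_obj B H) (flat_obj B K)) (Ident C (flat_obj B K))"
    by (rule coproduct_eqI[OF HB KB Comp_Hom[OF r(1) Q] q'(1)])
      (simp_all only: Comp_assoc[OF e(1) r(1) Q] Comp_assoc[OF e(2) r(1) Q] r(2,3) q'(2,3)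
        flat_arr_comp[OF B i(1) q(1), symmetric] flat_arr_comp[OF B i(2) q(1), symmetric] q(2,3)
        flat_arr_Ident[OF B K] flat_arr_zero[OF B H K])
  ultimately show ?thesis
    by (intro product_eqI[OF HB KB Comp_Hom[OF r(1) t(1)] \<Sigma>(1)])
      (simp_all only: Comp_assoc[OF r(1) t(1) proj_Hom(1)[OF HB KB], symmetric]
        Comp_assoc[OF r(1) t(1) proj_Hom(2)[OF HB KB], symmetric] t(2,3) \<Sigma>(2,3))
qed

text \<open>Projections jointly detect zero, and after \<open>\<Sigma>\<close> they are
  \<open>[1, 0]\<close> and \<open>[0, 1]\<close>.\<close>

lemma sum_to_prod_zeroI:
  assumes H: "H \<in> Obj C" and K: "K \<in> Obj C" and x: "x \<in> Hom C W (coprod_obj C H K)"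
    and "copairing C (Ident C H) (zero_arr C K H) \<cdot> x = zero_arr C W H"
    and "copairing C (zero_arr C H K) (Ident C K) \<cdot> x = zero_arr C W K"
  shows "sum_to_prod C H K \<cdot> x = zero_arr C W (prod_obj C H K)"
proof -
  note \<Sigma> = sum_to_prod_props[OF H K] and p = proj_Hom[OF H K]
  note W = Hom_Obj(1)[OF x] and P = Hom_Obj(1)[OF p(1)]
  show ?thesis
    by (rule product_eqI[OF H K Comp_Hom[OF x \<Sigma>(1)] zero_arr_Hom[OF W P]])
      (simp_all only: Comp_assoc[OF x \<Sigma>(1) p(1), symmetric] Comp_assoc[OF x \<Sigma>(1) p(2), symmetric]
        \<Sigma>(2,3) assms(4,5) comp_zero_arr[OF p(1) W] comp_zero_arr[OF p(2) W])
qed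

lemma comp_ker_sum_to_prod:
  assumes H: "H \<in> Obj C" and K: "K \<in> Obj C"
  shows "copairing C (Ident C H) (zero_arr C K H) \<cdot> ker C (sum_to_prod C H K)
      = zero_arr C (Ker C (sum_to_prod C H K)) H"
    and "copairing C (zero_arr C H K) (Ident C K) \<cdot> ker C (sum_to_prod C H K)
      = zero_arr C (Ker C (sum_to_prod C H K)) K"
proof -
  note \<Sigma> = sum_to_prod_props[OF H K] and p = proj_Hom[OF H K]
  note s = ker_Hom[OF \<Sigma>(1)]
  note D = Hom_Obj(1)[OF s]
  show "copairing C (Ident C H) (zero_arr C K H) \<cdot> ker C (sum_to_prod C H K)
      = zero_arr C (Ker C (sum_to_prod C H K)) H"
    by (simp only: \<Sigma>(2)[symmetric] Comp_assoc[OF s \<Sigma>(1) p(1)] comp_ker[OF \<Sigma>(1)] comp_zero_arr[OF p(1) D])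
  show "copairing C (zero_arr C H K) (Ident C K) \<cdot> ker C (sum_to_prod C H K)
      = zero_arr C (Ker C (sum_to_prod C H K)) K"
    by (simp only: \<Sigma>(3)[symmetric] Comp_assoc[OF s \<Sigma>(1) p(2)] comp_ker[OF \<Sigma>(1)] comp_zero_arr[OF p(2) D])
qed

text \<open>Along the canonical arrows, \<open>f + g\<close> corresponds to
  \<open>f \<times> g\<close>, as the two coordinate equations express; hence it maps kernel to
  kernel. The arrow \<open>v\<close> is \<open>f \<diamondop> g\<close>.\<close>

lemma sum_to_prod_ker_natural:
  assumes f: "f \<in> Hom C H' H" and g: "g \<in> Hom C K' K"
  shows "\<exists>v \<in> Hom C (Ker C (sum_to_prod C H' K')) (Ker C (sum_to_prod C H K)).
    ker C (sum_to_prod C H K) \<cdot> v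
      = copairing C (inj1 C H K \<cdot> f) (inj2 C H K \<cdot> g) \<cdot> ker C (sum_to_prod C H' K')"
    (is "\<exists>v \<in> _. _ = ?w \<cdot> ?s")
proof -
  note H' = Hom_Obj(1)[OF f] and H = Hom_Obj(2)[OF f] and K' = Hom_Obj(1)[OF g] and K = Hom_Obj(2)[OF g]
  note i = inj_Hom[OF H K] and i' = inj_Hom[OF H' K']
  note w = copairing_props[OF Comp_Hom[OF f i(1)] Comp_Hom[OF g i(2)]]
  note s = ker_Hom[OF sum_to_prod_props(1)[OF H' K']]
  note D = Hom_Obj(1)[OF s]
  note p = copairing_props[OF Ident_Hom[OF H] zero_arr_Hom[OF K H]]
    and q = copairing_props[OF zero_arr_Hom[OF H K] Ident_Hom[OF K]]
  note p' = copairing_props[OF Ident_Hom[OF H'] zero_arr_Hom[OF K' H']]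
    and q' = copairing_props[OF zero_arr_Hom[OF H' K'] Ident_Hom[OF K']]
  have 1: "copairing C (Ident C H) (zero_arr C K H) \<cdot> ?w = f \<cdot> copairing C (Ident C H') (zero_arr C K' H')"
    by (rule coproduct_eqI[OF H' K' Comp_Hom[OF w(1) p(1)] Comp_Hom[OF p'(1) f]])
      (simp_all only: Comp_assoc[OF i'(1) w(1) p(1)] Comp_assoc[OF i'(2) w(1) p(1)] w(2,3)
        Comp_assoc[OF f i(1) p(1), symmetric] Comp_assoc[OF g i(2) p(1), symmetric] p(2,3)
        Comp_assoc[OF i'(1) p'(1) f] Comp_assoc[OF i'(2) p'(1) f] p'(2,3)
        Comp_Ident_left[OF f] Comp_Ident_right[OF f] zero_arr_comp[OF g H] comp_zero_arr[OF f K'])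
  have 2: "copairing C (zero_arr C H K) (Ident C K) \<cdot> ?w = g \<cdot> copairing C (zero_arr C H' K') (Ident C K')"
    by (rule coproduct_eqI[OF H' K' Comp_Hom[OF w(1) q(1)] Comp_Hom[OF q'(1) g]])
      (simp_all only: Comp_assoc[OF i'(1) w(1) q(1)] Comp_assoc[OF i'(2) w(1) q(1)] w(2,3)
        Comp_assoc[OF f i(1) q(1), symmetric] Comp_assoc[OF g i(2) q(1), symmetric] q(2,3)
        Comp_assoc[OF i'(1) q'(1) g] Comp_assoc[OF i'(2) q'(1) g] q'(2,3)
        Comp_Ident_left[OF g] Comp_Ident_right[OF g] zero_arr_comp[OF f K] comp_zero_arr[OF g H'])
  have "sum_to_prod C H K \<cdot> (?w \<cdot> ?s) = zero_arr C (Ker C (sum_to_prod C H' K')) (prod_obj C H K)"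
    by (rule sum_to_prod_zeroI[OF H K Comp_Hom[OF s w(1)]])
      (simp_all only: Comp_assoc[OF s w(1) p(1), symmetric] Comp_assoc[OF s w(1) q(1), symmetric] 1 2
        Comp_assoc[OF s p'(1) f] Comp_assoc[OF s q'(1) g] comp_ker_sum_to_prod[OF H' K']
        comp_zero_arr[OF f D] comp_zero_arr[OF g D])
  from ker_factor[OF sum_to_prod_props(1)[OF H K] Comp_Hom[OF s w(1)] this]
  show ?thesis by blast
qed

text \<open>The diagonal property of regular epimorphisms is used twice to descend a factorization
  through \<open>m\<close>: along \<open>g\<close> onto \<open>Ker C t\<close>, and then along
  \<open>flat_arr B e\<close>.\<close>

lemma higgins_commutator_restricts_action:
  assumes pres: "preserves_jointly_strongly_epic (Pt C B) C (Ker_functor C B)" and B: "B \<in> Obj C"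
    and h: "h \<in> Hom C H G" and k: "k \<in> Hom C K G"
    and \<xi>: "\<xi> \<in> Hom C (flat_obj B G) G"
    and \<xi>H: "\<xi>H \<in> Hom C (flat_obj B H) H" "h \<cdot> \<xi>H = \<xi> \<cdot> flat_arr B h"
    and \<xi>K: "\<xi>K \<in> Hom C (flat_obj B K) K" "k \<cdot> \<xi>K = \<xi> \<cdot> flat_arr B k"
    and m: "monic C m" "m \<in> Hom C M G" and e: "regular_epi C e" "e \<in> Hom C (Ker C (sum_to_prod C H K)) M"
    and me: "copairing C h k \<cdot> ker C (sum_to_prod C H K) = m \<cdot> e"
  shows "\<exists>\<xi>' \<in> Hom C (flat_obj B M) M. m \<cdot> \<xi>' = \<xi> \<cdot> flat_arr B m"
proof -
  note H = Hom_Obj(1)[OF h] and K = Hom_Obj(1)[OF k]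
  note HB = flat_obj_Obj[OF B H] and KB = flat_obj_Obj[OF B K]
  define S c s D where "S = coprod_obj C H K" and "c = copairing C h k"
    and "s = ker C (sum_to_prod C H K)" and "D = Ker C (sum_to_prod C H K)"
  note i = inj_Hom[OF H K, folded S_def] and i' = inj_Hom[OF HB KB]
  note c = copairing_props[OF h k, folded S_def c_def]
  have s: "s \<in> Hom C D S"
    using ker_Hom[OF sum_to_prod_props(1)[OF H K]] by (simp add: s_def D_def S_def)
  note cF = flat_arr_props(1)[OF B c(1)] and sF = flat_arr_props(1)[OF B s]
    and mF = flat_arr_props(1)[OF B m(2)] and eF = flat_arr_props(1)[OF B e(2), folded D_def]
  note iF = flat_arr_props(1)[OF B i(1)] and jF = flat_arr_props(1)[OF B i(2)]
  note D = Hom_Obj(1)[OF s]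
  define r where "r = copairing C (flat_arr B (inj1 C H K)) (flat_arr B (inj2 C H K))"
  note r = copairing_props[OF iF jF, folded r_def]
  have r_epi: "regular_epi C r"
    unfolding r_def by (rule flat_copairing_regular_epi[OF pres B H K])
  note p = copairing_props[OF Ident_Hom[OF H] zero_arr_Hom[OF K H], folded S_def]
    and q = copairing_props[OF zero_arr_Hom[OF H K] Ident_Hom[OF K], folded S_def]
  note P = flat_arr_props(1)[OF B p(1)] and Q = flat_arr_props(1)[OF B q(1)]
  define t where "t = pairing C (flat_arr B (copairing C (Ident C H) (zero_arr C K H)))
        (flat_arr B (copairing C (zero_arr C H K) (Ident C K)))"
  note t = pairing_props[OF P Q, folded t_def]
  have tr: "sum_to_prod C (flat_obj B H) (flat_obj B K) = t \<cdot> r"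
    unfolding t_def r_def by (rule flat_pairing_copairing[OF B H K, symmetric])
  define s' D' where "s' = ker C (sum_to_prod C (flat_obj B H) (flat_obj B K))"
    and "D' = Ker C (sum_to_prod C (flat_obj B H) (flat_obj B K))"
  have s': "s' \<in> Hom C D' (coprod_obj C (flat_obj B H) (flat_obj B K))"
    using ker_Hom[OF sum_to_prod_props(1)[OF HB KB]] by (simp add: s'_def D'_def)
  note n = ker_Hom[OF t(1)]

  \<comment> \<open>Because \<open>t \<cdot> r\<close> is the canonical arrow with kernel
    \<open>s'\<close>, the arrow \<open>r\<close> restricts to an arrow \<open>g\<close> between the
    kernels, which inherits regularity from \<open>r\<close>.\<close>
  have "t \<cdot> (r \<cdot> s') = zero_arr C D' (prod_obj C (flat_obj B H) (flat_obj B K))"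
    using comp_ker[OF sum_to_prod_props(1)[OF HB KB], folded s'_def D'_def]
    by (simp only: tr Comp_assoc[OF s' r(1) t(1)])
  then obtain g where g: "g \<in> Hom C D' (Ker C t)" "ker C t \<cdot> g = r \<cdot> s'"
    using ker_factor[OF t(1) Comp_Hom[OF s' r(1)]] by blast
  have g_epi: "regular_epi C g"
    by (rule regular_epi_on_kernels[OF r_epi r(1) t(1) tr, folded s'_def D'_def, OF g])

  note pr = proj_Hom[OF HB KB]
  note DB = flat_obj_Obj[OF B D]
  note z = comp_ker_sum_to_prod[OF H K, folded s_def D_def]
  \<comment> \<open>Each coordinate is the image under \<open>flat_arr B\<close> of a zero arrow,
    since \<open>s\<close> is killed by \<open>[1, 0]\<close> and \<open>[0, 1]\<close>.\<close>
  have "t \<cdot> flat_arr B s = zero_arr C (flat_obj B D) (prod_obj C (flat_obj B H) (flat_obj B K))"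
    by (rule product_eqI[OF HB KB Comp_Hom[OF sF t(1)] zero_arr_Hom[OF DB Hom_Obj(1)[OF pr(1)]]])
      (simp_all only: Comp_assoc[OF sF t(1) pr(1), symmetric] Comp_assoc[OF sF t(1) pr(2), symmetric]
        t(2,3) flat_arr_comp[OF B s p(1), symmetric] flat_arr_comp[OF B s q(1), symmetric] z
        flat_arr_zero[OF B D H] flat_arr_zero[OF B D K] comp_zero_arr[OF pr(1) DB] comp_zero_arr[OF pr(2) DB])
  then obtain w where w: "w \<in> Hom C (flat_obj B D) (Ker C t)" "ker C t \<cdot> w = flat_arr B s"
    using ker_factor[OF t(1) sF] by blast

  note fH = Comp_Hom[OF \<xi>H(1) i(1)] and fK = Comp_Hom[OF \<xi>K(1) i(2)]
  note x = copairing_props[OF fH fK]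
  note cr = Comp_Hom[OF r(1) Comp_Hom[OF cF \<xi>]]
  \<comment> \<open>Here \<open>v\<close> is \<open>\<xi>H \<diamondop> \<xi>K\<close>, the effect
    of the two restricted actions on the kernels.\<close>
  obtain v where v: "v \<in> Hom C D' D"
      "s \<cdot> v = copairing C (inj1 C H K \<cdot> \<xi>H) (inj2 C H K \<cdot> \<xi>K) \<cdot> s'"
    using sum_to_prod_ker_natural[OF \<xi>H(1) \<xi>K(1)] unfolding s_def D_def s'_def D'_def by blast
  \<comment> \<open>On each summand this is the defining equation of \<open>\<xi>H\<close> or
    \<open>\<xi>K\<close>, as \<open>c\<close> restricts to \<open>h\<close> and
    \<open>k\<close>.\<close>
  have equiv: "(\<xi> \<cdot> flat_arr B c) \<cdot> r = c \<cdot> copairing C (inj1 C H K \<cdot> \<xi>H) (inj2 C H K \<cdot> \<xi>K)"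
    by (rule coproduct_eqI[OF HB KB cr Comp_Hom[OF x(1) c(1)]])
      (simp_all only: Comp_assoc[OF i'(1) r(1) Comp_Hom[OF cF \<xi>]]
        Comp_assoc[OF i'(2) r(1) Comp_Hom[OF cF \<xi>]] r(2,3)
        Comp_assoc[OF iF cF \<xi>] Comp_assoc[OF jF cF \<xi>]
        flat_arr_comp[OF B i(1) c(1), symmetric] flat_arr_comp[OF B i(2) c(1), symmetric] c(2,3)
        Comp_assoc[OF i'(1) x(1) c(1)] Comp_assoc[OF i'(2) x(1) c(1)] x(2,3)
        Comp_assoc[OF \<xi>H(1) i(1) c(1), symmetric] Comp_assoc[OF \<xi>K(1) i(2) c(1), symmetric]
        \<xi>H(2) \<xi>K(2))
  have cs: "c \<cdot> s = m \<cdot> e" using me by (simp add: c_def s_def)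
  have e2: "e \<in> Hom C D M" using e(2) by (simp add: D_def)

  \<comment> \<open>The action on \<open>G\<close>, restricted to \<open>Ker C t\<close>. Composed
    with \<open>g\<close> it becomes \<open>c \<cdot> s \<cdot> v\<close>, and
    \<open>c \<cdot> s\<close> factors through \<open>m\<close>.\<close>
  define y where "y = (\<xi> \<cdot> flat_arr B c) \<cdot> ker C t"
  have y: "y \<in> Hom C (Ker C t) G"
    unfolding y_def by (rule Comp_Hom[OF n Comp_Hom[OF cF \<xi>]])
  have "y \<cdot> g = ((\<xi> \<cdot> flat_arr B c) \<cdot> r) \<cdot> s'"
    by (simp only: y_def Comp_assoc[OF g(1) n Comp_Hom[OF cF \<xi>]] g(2)
        Comp_assoc[OF s' r(1) Comp_Hom[OF cF \<xi>]])
  also have "\<dots> = (c \<cdot> s) \<cdot> v"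
    by (simp only: equiv Comp_assoc[OF s' x(1) c(1)] v(2)[symmetric] Comp_assoc[OF v(1) s c(1)])
  also have "\<dots> = m \<cdot> (e \<cdot> v)"
    by (simp only: cs Comp_assoc[OF v(1) e2 m(2)])
  finally have yg: "y \<cdot> g = m \<cdot> (e \<cdot> v)" .
  have "\<exists>d \<in> Hom C (Cod C g) (Dom C m). y = m \<cdot> d"
    by (rule regular_epi_diagonal[OF g_epi m(1) _ _ yg])
      (use y g(1) m(2) Comp_Hom[OF v(1) e2] in \<open>auto simp: Hom_def\<close>)
  then obtain d where d: "d \<in> Hom C (Ker C t) M" "y = m \<cdot> d"
    using g(1) m(2) by (auto simp: Hom_def)

  \<comment> \<open>As \<open>m \<cdot> e = c \<cdot> s\<close> and \<open>flat_arr B s\<close>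
    passes through \<open>Ker C t\<close> by \<open>w\<close>, the composite is
    \<open>y \<cdot> w\<close>, where the factorization of \<open>y\<close> is available.\<close>
  have "(\<xi> \<cdot> flat_arr B m) \<cdot> flat_arr B e = \<xi> \<cdot> flat_arr B (c \<cdot> s)"
    by (simp only: Comp_assoc[OF eF mF \<xi>] cs flat_arr_comp[OF B e2 m(2)])
  also have "\<dots> = y \<cdot> w"
    by (simp only: flat_arr_comp[OF B s c(1)] Comp_assoc[OF sF cF \<xi>] w(2) y_def
        Comp_assoc[OF w(1) n Comp_Hom[OF cF \<xi>]])
  also have "\<dots> = m \<cdot> (d \<cdot> w)"
    by (simp only: d(2) Comp_assoc[OF w(1) d(1) m(2)])
  finally have fin: "(\<xi> \<cdot> flat_arr B m) \<cdot> flat_arr B e = m \<cdot> (d \<cdot> w)" .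
  have "\<exists>\<xi>' \<in> Hom C (Cod C (flat_arr B e)) (Dom C m). \<xi> \<cdot> flat_arr B m = m \<cdot> \<xi>'"
    by (rule regular_epi_diagonal[OF flat_arr_regular_epi[OF B e(1)] m(1) _ _ fin])
      (use eF m(2) Comp_Hom[OF mF \<xi>] Comp_Hom[OF w(1) d(1)] in \<open>auto simp: Hom_def\<close>)
  then obtain \<xi>' where "\<xi>' \<in> Hom C (flat_obj B M) M" "m \<cdot> \<xi>' = \<xi> \<cdot> flat_arr B m"
    using eF m(2) by (auto simp: Hom_def)
  then show ?thesis by blast
qed

section \<open>Assembling the characteristic subobject\<close>

lemma characteristicD:
  assumes "characteristic C G h" "B \<in> Obj C" "is_action C B G \<xi>"
  shows "\<exists>\<xi>' \<in> Hom C (flat_obj B (Dom C h)) (Dom C h). h \<cdot> \<xi>' = \<xi> \<cdot> flat_arr B h"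
proof -
  obtain \<xi>' where \<xi>': "is_action C B (Dom C h) \<xi>'" "h \<cdot> \<xi>' = \<xi> \<cdot> flat_arr B h"
    using assms unfolding characteristic_def by blast
  from \<xi>'(1) have "\<xi>' \<in> Hom C (flat_obj B (Dom C h)) (Dom C h)"
    by (simp add: is_action_def is_algebra_def flat_monad_def adjunction_monad_def Ker_functor_def
        plus_functor_def plus_obj_def)
  with \<xi>'(2) show ?thesis by blast
qed

text \<open>For each action on \<open>G\<close>, its restrictions to the two given subobjects feed
  the previous construction; the image factorization behind the chosen \<open>regular_image\<close>
  supplies \<open>m\<close> and \<open>e\<close>.\<close>

lemma characteristic_higgins_commutator:
  assumes pres: "\<forall>B \<in> Obj C. preserves_jointly_strongly_epic (Pt C B) C (Ker_functor C B)"
    and ch: "characteristic C G h" and ck: "characteristic C G k"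
  shows "characteristic C G (higgins_commutator C h k)"
proof -
  have h: "h \<in> Hom C (Dom C h) G" and k: "k \<in> Hom C (Dom C k) G"
    using ch ck by (auto simp: characteristic_def monic_def Hom_def)
  define s where "s = ker C (sum_to_prod C (Dom C h) (Dom C k))"
  have s: "s \<in> Hom C (Ker C (sum_to_prod C (Dom C h) (Dom C k))) (coprod_obj C (Dom C h) (Dom C k))"
    unfolding s_def by (rule ker_Hom[OF sum_to_prod_props(1)[OF Hom_Obj(1)[OF h] Hom_Obj(1)[OF k]]])
  note f = Comp_Hom[OF s copairing_props(1)[OF h k]]
  define m where "m = higgins_commutator C h k"
  have "is_regular_image C (copairing C h k \<cdot> s) m"
    using regular_image_is_regular_image[of "copairing C h k \<cdot> s"] f
    by (simp add: m_def higgins_commutator_def s_def Hom_def)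
  then obtain e where m: "monic C m" and e: "regular_epi C e" "Cod C e = Dom C m"
      and me: "copairing C h k \<cdot> s = m \<cdot> e"
    by (auto simp: is_regular_image_def)
  have mA: "m \<in> Arr C" and eA: "e \<in> Arr C" using m e regular_epi_Arr by (auto simp: monic_def)
  have mH: "m \<in> Hom C (Dom C m) G"
    and eH: "e \<in> Hom C (Ker C (sum_to_prod C (Dom C h) (Dom C k))) (Dom C m)"
    using f mA eA e(2) unfolding me by (auto simp: comp_simps)
  show ?thesis
    unfolding m_def[symmetric]
  proof (rule characteristicI[OF m mH])
    fix B \<xi> assume B: "B \<in> Obj C" and act: "is_action C B G \<xi>"
    have \<xi>: "\<xi> \<in> Hom C (flat_obj B G) G"
      using act by (simp add: is_action_def is_algebra_def flat_monad_def adjunction_monad_def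
          Ker_functor_def plus_functor_def plus_obj_def)
    obtain \<xi>H \<xi>K where "\<xi>H \<in> Hom C (flat_obj B (Dom C h)) (Dom C h)" "h \<cdot> \<xi>H = \<xi> \<cdot> flat_arr B h"
      "\<xi>K \<in> Hom C (flat_obj B (Dom C k)) (Dom C k)" "k \<cdot> \<xi>K = \<xi> \<cdot> flat_arr B k"
      using characteristicD[OF ch B act] characteristicD[OF ck B act] by blast
    from higgins_commutator_restricts_action[OF _ B h k \<xi> this m mH e(1) eH me[unfolded s_def]]
    show "\<exists>\<xi>' \<in> Hom C (flat_obj B (Dom C m)) (Dom C m). m \<cdot> \<xi>' = \<xi> \<cdot> flat_arr B m"
      using pres B by blast
  qed
qed

end

sublocale semi_abelian \<subseteq> pointed_regular_category
  by unfold_locales (fact pointed finite_coproducts)+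

theorem proposition4p4:
  fixes C :: "('o, 'm) cat" and G :: 'o and h k :: 'm
  assumes "semi_abelian C"
    and "\<forall>B \<in> Obj C. preserves_jointly_strongly_epic (Pt C B) C (Ker_functor C B)"
    and "G \<in> Obj C"
    and "characteristic C G h"
    and "characteristic C G k"
  shows "characteristic C G (higgins_commutator C h k)"
proof -
  interpret semi_abelian C by fact
  show ?thesis by (rule characteristic_higgins_commutator) fact+
qed

end
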